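(* Let $Z$ be a JB*-triple with open unit ball $B$ and let $X$ be any (complex) Banach space. Let $f:B\to X$ be holomorphic on $B$ with a continuous extension to $\overline{B}$ (also denoted $f$). Let $\Gamma$ be the set of maximal tripotents of $Z$ and $\Gamma_1$ the set of unitary tripotents of $Z$. (1) If $Z$ contains a maximal tripotent then $f(\overline{B})\subseteq\overline{\operatorname{co}}(f(\Gamma))$ and $$\sup\{\|f(z)\|:z\in\overline{B}\}=\sup\{\|f(z)\|:z\in\Gamma\}.$$ (2) If $Z$ contains a unitary tripotent then $f(\overline{B})\subseteq\overline{\operatorname{co}}(f(\Gamma_1))$ and $$\sup\{\|f(z)\|:z\in\overline{B}\}=\sup\{\|f(z)\|:z\in\Gamma_1\}.$$
   Context: A JB*-triple is a complex Banach space $Z$ with a real trilinear map $\{\cdot,\cdot,\cdot\}:Z\times Z\times Z\to Z$ such that: (i) $\{x,y,z\}$ is complex linear and symmetric in the outer variables $x,z$ and complex anti-linear in $y$; (ii) for every $x\in Z$ the map $x\square x: z\mapsto\{x,x,z\}$ is a Hermitian operator with spectrum contained in $[0,\infty)$ and $\|x\square x\|=\|x\|^2$; (iii) $\{a,b,\{x,y,z\}\}=\{\{a,b,x\},y,z\}-\{x,\{b,a,y\},z\}+\{x,y,\{a,b,z\}\}$ for all $a,b,x,y,z\in Z$. A tripotent is an element $e\in Z$ with $\{e,e,e\}=e$. It is maximal if $\{z\in Z:\{e,e,z\}=0\}=\{0\}$, and unitary if $\{e,e,z\}=z$ for all $z\in Z$. $\overline{\operatorname{co}}(S)$ denotes the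 norm-closed convex hull of $S$. Suprema are taken in $[0,\infty]$ and may be infinite. *)

theory Defs
  imports "HOL-Analysis.Analysis"
begin

class complex_normed_vector = real_normed_vector +
  fixes scaleC :: "complex \<Rightarrow> 'a \<Rightarrow> 'a"  (infixr "*\<^sub>C" 75)
  assumes scaleC_add_right: "c *\<^sub>C (x + y) = c *\<^sub>C x + c *\<^sub>C y"
    and scaleC_add_left: "(c + d) *\<^sub>C x = c *\<^sub>C x + d *\<^sub>C x"
    and scaleC_scaleC: "c *\<^sub>C d *\<^sub>C x = (c * d) *\<^sub>C x"
    and scaleC_of_real: "complex_of_real r *\<^sub>C x = r *\<^sub>R x"
    and norm_scaleC: "norm (c *\<^sub>C x) = cmod c * norm x"

class complex_banach = complex_normed_vector + banach

definition clinear :: "('a::complex_normed_vector \<Rightarrow> 'b::complex_normed_vector) \<Rightarrow> bool" where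
  "clinear T \<longleftrightarrow> (\<forall>x y. T (x + y) = T x + T y) \<and> (\<forall>c x. T (c *\<^sub>C x) = c *\<^sub>C T x)"

definition antilinear :: "('a::complex_normed_vector \<Rightarrow> 'b::complex_normed_vector) \<Rightarrow> bool" where
  "antilinear T \<longleftrightarrow> (\<forall>x y. T (x + y) = T x + T y) \<and> (\<forall>c x. T (c *\<^sub>C x) = cnj c *\<^sub>C T x)"

definition bounded_clinear :: "('a::complex_normed_vector \<Rightarrow> 'b::complex_normed_vector) \<Rightarrow> bool" where
  "bounded_clinear T \<longleftrightarrow> clinear T \<and> bounded_linear T"

text \<open>Frechet differentiability over the complex numbers: the real Frechet derivative
  exists at every point of \<open>U\<close> and is complex linear. Meant for open \<open>U\<close>.\<close>

definition holomorphic_banach ::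
    "('a::complex_normed_vector \<Rightarrow> 'b::complex_normed_vector) \<Rightarrow> 'a set \<Rightarrow> bool" where
  "holomorphic_banach f U \<longleftrightarrow>
     (\<forall>z\<in>U. \<exists>D. bounded_clinear D \<and> (f has_derivative D) (at z))"

definition operator_spectrum :: "('a::complex_banach \<Rightarrow> 'a) \<Rightarrow> complex set" where
  "operator_spectrum T = {\<mu>. \<not> (\<exists>S. bounded_clinear S \<and>
     (\<forall>z. S (\<mu> *\<^sub>C z - T z) = z) \<and> (\<forall>z. \<mu> *\<^sub>C S z - T (S z) = z))}"

text \<open>The operator \<open>exp (c T)\<close>, evaluated pointwise. For bounded \<open>T\<close> the exponential series
  converges in operator norm, so the pointwise sum is its value.\<close>

definition operator_exp :: "complex \<Rightarrow> ('a::complex_banach \<Rightarrow> 'a) \<Rightarrow> 'a \<Rightarrow> 'a" where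
  "operator_exp c T z = (\<Sum>n. (c ^ n / fact n) *\<^sub>C (T ^^ n) z)"

text \<open>A bounded operator \<open>T\<close> on a complex Banach space is Hermitian if \<open>exp (i t T)\<close> is an
  isometry for every real \<open>t\<close>.\<close>

definition hermitian_operator :: "('a::complex_banach \<Rightarrow> 'a) \<Rightarrow> bool" where
  "hermitian_operator T \<longleftrightarrow> bounded_clinear T \<and>
     (\<forall>(t::real) z. norm (operator_exp (\<i> * of_real t) T z) = norm z)"

text \<open>The operator \<open>x \<box> y\<close> is the partial application \<open>triple x y\<close>. Real trilinearity and
  linearity in the third variable follow from the first three assumptions.\<close>

locale jbstar_triple =
  fixes triple :: "'z::complex_banach \<Rightarrow> 'z \<Rightarrow> 'z \<Rightarrow> 'z"
  assumes clinear_outer: "clinear (\<lambda>x. triple x y z)"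
    and symmetric_outer: "triple x y z = triple z y x"
    and antilinear_inner: "antilinear (\<lambda>y. triple x y z)"
    and hermitian_box: "hermitian_operator (triple x x)"
    and spectrum_box: "operator_spectrum (triple x x) \<subseteq> complex_of_real ` {0..}"
    and onorm_box: "onorm (triple x x) = (norm x)\<^sup>2"
    and jordan_identity:
      "triple a b (triple x y z) =
         triple (triple a b x) y z - triple x (triple b a y) z + triple x y (triple a b z)"

definition tripotent :: "('z \<Rightarrow> 'z \<Rightarrow> 'z \<Rightarrow> 'z) \<Rightarrow> 'z \<Rightarrow> bool" where
  "tripotent triple e \<longleftrightarrow> triple e e e = e"

definition maximal_tripotents :: "('z::zero \<Rightarrow> 'z \<Rightarrow> 'z \<Rightarrow> 'z) \<Rightarrow> 'z set" where
  "maximal_tripotents triple = {e. tripotent triple e \<and> {z. triple e e z = 0} = {0}}"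

definition unitary_tripotents :: "('z \<Rightarrow> 'z \<Rightarrow> 'z \<Rightarrow> 'z) \<Rightarrow> 'z set" where
  "unitary_tripotents triple = {e. tripotent triple e \<and> (\<forall>z. triple e e z = z)}"

end

theory Submission
  imports Defs "HOL-Complex_Analysis.Conformal_Mappings"
begin

text \<open>
  The proof draws, through a given point \<open>z\<close> of the open ball, an analytic disc whose boundary
  lies in the set \<open>G\<close> of tripotents under consideration, and applies the maximum principle to \<open>f\<close>
  along that disc.

  Consider the differential equation \<open>x' = a t - {x, a t, x}\<close> for \<open>t\<close> in \<open>[0, 1]\<close>. Its right-hand
  side is holomorphic in \<open>x\<close>, so its solutions depend holomorphically on the initial value. If
  \<open>a t = z + t\<^sup>2 {z,z,z} + t\<^sup>4 {z,z,{z,z,z}} + \<dots>\<close>, then \<open>x t = t z\<close> is the solution that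
  starts at \<open>0\<close>, and it ends at \<open>z\<close> (\<open>radial_control\<close>). The series converges by
  \<open>\<parallel>z \<box> z\<parallel> = \<parallel>z\<parallel>\<^sup>2 < 1\<close>. On the other hand, at a maximal tripotent \<open>e\<close> the vector
  \<open>a - {e, a, e}\<close> is \<open>D e\<close> for an inner derivation \<open>D\<close>, because the Peirce space \<open>Z_0\<close> of \<open>e\<close>
  vanishes (\<open>maximal_tripotent_tangent\<close>). Exponentials of derivations are automorphisms of the
  triple, and \<open>G\<close> is invariant under automorphisms, so a solution that starts in \<open>G\<close> remains in
  \<open>G\<close>. Hence the solutions with initial values \<open>\<zeta> e\<close>, where \<open>e\<close> is a fixed element of \<open>G\<close> and
  \<open>\<bar>\<zeta>\<bar> \<le> 1\<close>, should form a disc with centre \<open>z\<close> and boundary in \<open>G\<close>.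

  The equation is never solved inside the ball. For the Euler polygons with \<open>2 ^ m\<close> steps the end
  point is a polynomial in \<open>\<zeta>\<close>, and its value at \<open>\<zeta> = 0\<close> is exactly \<open>z\<close>. On the circle, replacing
  each Euler step by the exponential of the derivation gives points of \<open>G\<close> and changes the step by
  \<open>O(h\<^sup>2)\<close> only. A discrete Gronwall estimate then shows that the polygons converge, uniformly on
  the circle, to points of the closed set \<open>G\<close> (\<open>euler_limit_in_viable_set\<close>,
  \<open>disc_through_point\<close>).

  The maximum principle that is used says: if \<open>g\<close> maps the closed disc holomorphically into a
  complex normed space and maps the circle within distance \<open>\<epsilon>\<close> of a convex set \<open>C\<close>, then it maps
  the whole disc within distance \<open>\<epsilon>\<close> of \<open>C\<close> (\<open>maximum_principle_infdist\<close>). It follows from the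
  scalar principle and a Hahn-Banach functional that supports the convex function
  \<open>x \<mapsto> dist x C\<close>. With \<open>C = {0}\<close> it bounds the polygons on the whole disc; with \<open>C\<close> the convex hull
  of \<open>f G\<close>, and \<open>g\<close> equal to \<open>f\<close> along a slightly shrunk polygon, it gives the theorem.
  Both parts are the same statement, for \<open>G\<close> the set of maximal or of unitary tripotents.
\<close>

section \<open>Complex normed spaces\<close>

lemma scaleC_minus_one: "(-1) *\<^sub>C x = - (x::'a::complex_normed_vector)"
  using scaleC_of_real[of "-1" x] by simp

lemma scaleC_scaleR: "c *\<^sub>C (r *\<^sub>R x) = r *\<^sub>R (c *\<^sub>C (x::'a::complex_normed_vector))"
  by (metis scaleC_scaleC scaleC_of_real mult.commute)

lemma scaleC_one [simp]: "1 *\<^sub>C x = (x::'a::complex_normed_vector)"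
  using scaleC_of_real[of 1 x] by simp

lemma bounded_linear_scaleC_left: "bounded_linear (\<lambda>c. c *\<^sub>C (x::'a::complex_normed_vector))"
proof (rule bounded_linear_intro[of _ "norm x"])
  show "(r *\<^sub>R c) *\<^sub>C x = r *\<^sub>R (c *\<^sub>C x)" for r c
    by (metis scaleC_scaleC scaleC_of_real scaleR_conv_of_real)
qed (auto simp: scaleC_add_left norm_scaleC)

lemma bounded_linear_scaleC: "bounded_linear (\<lambda>x::'a::complex_normed_vector. c *\<^sub>C x)"
  by (rule bounded_linear_intro[of _ "cmod c"])
     (auto simp: scaleC_add_right scaleC_scaleR norm_scaleC mult.commute)

lemma scaleC_diff_right: "c *\<^sub>C (x - y) = c *\<^sub>C x - c *\<^sub>C (y::'a::complex_normed_vector)"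
  by (rule linear_diff[OF bounded_linear.linear[OF bounded_linear_scaleC]])

section \<open>Dominated linear functionals and the maximum principle\<close>

definition sublinear :: "('a::real_vector \<Rightarrow> real) \<Rightarrow> bool" where
  "sublinear q \<longleftrightarrow> (\<forall>x y. q (x + y) \<le> q x + q y) \<and> (\<forall>c\<ge>0. \<forall>x. q (c *\<^sub>R x) = c * q x)"

lemma sublinear_zero: "sublinear q \<Longrightarrow> q 0 = 0"
  unfolding sublinear_def by (metis order_refl mult_zero_left scaleR_zero_left)

lemma sublinear_scaleI:
  fixes q :: "'a::real_vector \<Rightarrow> real"
  assumes "q 0 = 0" "\<And>c x. c > 0 \<Longrightarrow> q (c *\<^sub>R x) \<le> c * q x" "c \<ge> 0"
  shows "q (c *\<^sub>R x) = c * q x"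
proof (cases "c = 0")
  case False
  then have c: "c > 0" using assms(3) by simp
  have "q ((1/c) *\<^sub>R (c *\<^sub>R x)) \<le> (1/c) * q (c *\<^sub>R x)"
    using c by (intro assms(2)) simp
  then have "q x \<le> q (c *\<^sub>R x) / c" using c by simp
  then have "c * q x \<le> q (c *\<^sub>R x)" using c by (simp add: field_simps)
  then show ?thesis using assms(2)[OF c, of x] by simp
qed (use assms in simp)

text \<open>
  The functional \<open>u \<mapsto> inf {q (u + t y) - t q y | t \<ge> 0}\<close> is sublinear and below \<open>q\<close>, hence
  equal to \<open>q\<close>; the value \<open>t = 1\<close> gives superadditivity.
\<close>

lemma minimal_sublinear_additive:
  fixes q :: "'a::real_vector \<Rightarrow> real"
  assumes q: "sublinear q" and minimal: "\<And>r. sublinear r \<Longrightarrow> r \<le> q \<Longrightarrow> r = q"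
  shows "q (x + y) = q x + q y"
proof -
  have sub: "q (u + v) \<le> q u + q v" and hom: "c \<ge> 0 \<Longrightarrow> q (c *\<^sub>R u) = c * q u" for u v c
    using q by (auto simp: sublinear_def)
  define S where "S u = (\<lambda>t. q (u + t *\<^sub>R y) - t * q y) ` {0..}" for u
  define r where "r u = Inf (S u)" for u
  have low: "- q (- u) \<le> s" if "s \<in> S u" for s u
  proof -
    obtain t where t: "t \<ge> 0" "s = q (u + t *\<^sub>R y) - t * q y" using \<open>s \<in> S u\<close> by (auto simp: S_def)
    have "t * q y = q ((u + t *\<^sub>R y) + (- u))" using hom[OF t(1), of y] by simp
    also have "\<dots> \<le> q (u + t *\<^sub>R y) + q (- u)" by (rule sub)
    finally show ?thesis using t by simp
  qed
  have bdd: "bdd_below (S u)" for u using low by (rule bdd_belowI)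
  have ne: "S u \<noteq> {}" for u by (auto simp: S_def)
  have rle: "r u \<le> q (u + t *\<^sub>R y) - t * q y" if "t \<ge> 0" for u t
    unfolding r_def by (rule cInf_lower[OF _ bdd]) (use that in \<open>auto simp: S_def\<close>)
  have rq: "r \<le> q" using rle[of 0] by (auto simp: le_fun_def)
  have radd: "r (u + v) \<le> r u + r v" for u v
  proof -
    have 1: "r (u + v) \<le> a + b" if a: "a \<in> S u" and b: "b \<in> S v" for a b
    proof -
      obtain s t where st: "s \<ge> 0" "t \<ge> 0" "a = q (u + s *\<^sub>R y) - s * q y" "b = q (v + t *\<^sub>R y) - t * q y"
        using a b by (auto simp: S_def)
      have "r (u + v) \<le> q ((u + v) + (s + t) *\<^sub>R y) - (s + t) * q y"
        using st by (intro rle) simp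
      also have "(u + v) + (s + t) *\<^sub>R y = (u + s *\<^sub>R y) + (v + t *\<^sub>R y)" by (simp add: algebra_simps)
      also have "q \<dots> \<le> q (u + s *\<^sub>R y) + q (v + t *\<^sub>R y)" by (rule sub)
      finally show ?thesis using st by (simp add: algebra_simps)
    qed
    have "r (u + v) - b \<le> r u" if "b \<in> S v" for b
      unfolding r_def[of u] by (rule cInf_greatest[OF ne]) (use 1 that in fastforce)
    then have "r (u + v) - r u \<le> r v"
      unfolding r_def[of v] by (intro cInf_greatest[OF ne]) fastforce
    then show ?thesis by simp
  qed
  have rscale: "r (c *\<^sub>R u) \<le> c * r u" if c: "c > 0" for c u
  proof -
    have "r (c *\<^sub>R u) / c \<le> a" if "a \<in> S u" for a
    proof -
      obtain t where t: "t \<ge> 0" "a = q (u + t *\<^sub>R y) - t * q y" using \<open>a \<in> S u\<close> by (auto simp: S_def)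
      have "r (c *\<^sub>R u) \<le> q (c *\<^sub>R u + (c * t) *\<^sub>R y) - (c * t) * q y" using c t by (intro rle) simp
      also have "c *\<^sub>R u + (c * t) *\<^sub>R y = c *\<^sub>R (u + t *\<^sub>R y)" by (simp add: algebra_simps)
      also have "q \<dots> = c * q (u + t *\<^sub>R y)" using c by (intro hom) simp
      finally have "r (c *\<^sub>R u) \<le> c * a" unfolding t(2) by (simp add: algebra_simps)
      then show ?thesis using c by (simp add: field_simps)
    qed
    then have "r (c *\<^sub>R u) / c \<le> r u" unfolding r_def[of u] by (rule cInf_greatest[OF ne])
    then show ?thesis using c by (simp add: field_simps)
  qed
  have "r 0 \<ge> 0" unfolding r_def
    by (rule cInf_greatest[OF ne]) (use low sublinear_zero[OF q] in fastforce)
  moreover have "r 0 \<le> 0" using rq sublinear_zero[OF q] by (metis le_funD)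
  ultimately have "r 0 = 0" by simp
  then have "sublinear r" unfolding sublinear_def
    using radd sublinear_scaleI[of r, OF _ rscale] by blast
  then have "r = q" using rq minimal by blast
  then have "q x \<le> q (x + y) - q y" using rle[of 1 x] by simp
  then show ?thesis using sub[of x y] by simp
qed

lemma sublinear_Inf_chain:
  fixes C :: "('a::real_vector \<Rightarrow> real) set"
  assumes "C \<noteq> {}" and sub: "\<And>q. q \<in> C \<Longrightarrow> sublinear q" 
    and chain: "\<And>q r. q \<in> C \<Longrightarrow> r \<in> C \<Longrightarrow> q \<le> r \<or> r \<le> q"
    and bdd: "\<And>x. bdd_below ((\<lambda>q. q x) ` C)"
  shows "sublinear (\<lambda>x. INF q\<in>C. q x)"
proof -
  define i where "i x = (INF q\<in>C. q x)" for x
  have lower: "i x \<le> q x" if "q \<in> C" for q x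
    unfolding i_def by (rule cINF_lower[OF bdd that])
  have add: "i (x + y) \<le> i x + i y" for x y
  proof -
    have 1: "i (x + y) \<le> q x + r y" if qr: "q \<in> C" "r \<in> C" for q r
    proof -
      obtain s where s: "s \<in> C" "s \<le> q" "s \<le> r" using chain[OF qr] qr by blast
      have "i (x + y) \<le> s (x + y)" using s by (intro lower)
      also have "\<dots> \<le> s x + s y" using sub[OF s(1)] by (simp add: sublinear_def)
      also have "\<dots> \<le> q x + r y" using s by (intro add_mono) (auto simp: le_fun_def)
      finally show ?thesis .
    qed
    have "i (x + y) - r y \<le> i x" if "r \<in> C" for r
      unfolding i_def[of x] by (rule cINF_greatest[OF \<open>C \<noteq> {}\<close>]) (use 1 that in fastforce)
    then have "i (x + y) - i x \<le> i y"
      unfolding i_def[of y] by (intro cINF_greatest[OF \<open>C \<noteq> {}\<close>]) fastforce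
    then show ?thesis by simp
  qed
  have zero: "i 0 = 0" 
  proof -
    have "(\<lambda>q. q 0) ` C = {0}" using \<open>C \<noteq> {}\<close> sublinear_zero[OF sub] by force
    then show ?thesis by (simp add: i_def)
  qed
  have scale: "i (c *\<^sub>R x) \<le> c * i x" if c: "c > 0" for c x
  proof -
    have "i (c *\<^sub>R x) / c \<le> q x" if "q \<in> C" for q
      using lower[OF that, of "c *\<^sub>R x"] sub[OF that] c by (simp add: sublinear_def field_simps)
    then have "i (c *\<^sub>R x) / c \<le> i x" unfolding i_def[of x] by (rule cINF_greatest[OF \<open>C \<noteq> {}\<close>])
    then show ?thesis using c by (simp add: field_simps)
  qed
  have "sublinear i" unfolding sublinear_def
    using add sublinear_scaleI[of i, OF zero scale] by blast
  then show ?thesis by (simp add: i_def[abs_def])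
qed

text \<open>
  Hahn-Banach: by Zorn's lemma there is a minimal sublinear functional below \<open>p\<close>, and minimal
  sublinear functionals are linear. Chains have lower bounds because a sublinear \<open>q \<le> p\<close> satisfies
  \<open>q x \<ge> - p (- x)\<close>.
\<close>

lemma sublinear_dominates_linear:
  fixes p :: "'a::real_vector \<Rightarrow> real"
  assumes p: "sublinear p"
  shows "\<exists>\<phi>. linear \<phi> \<and> (\<forall>x. \<phi> x \<le> p x)"
proof -
  define A where "A = {q. sublinear q \<and> q \<le> p}"
  let ?P = "\<lambda>q r :: 'a \<Rightarrow> real. r \<le> q"
  have "\<exists>m\<in>A. \<forall>a\<in>A. ?P m a \<longrightarrow> a = m"
  proof (rule predicate_Zorn)
    show "partial_order_on A (relation_of ?P A)"
      by (auto simp: partial_order_on_def preorder_on_def relation_of_def refl_on_def trans_def antisym_def)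
    fix C assume C: "C \<in> Chains (relation_of ?P A)"
    then have CA: "C \<subseteq> A" and ch: "\<And>q r. q \<in> C \<Longrightarrow> r \<in> C \<Longrightarrow> q \<le> r \<or> r \<le> q"
      by (auto simp: Chains_def relation_of_def)
    show "\<exists>u\<in>A. \<forall>a\<in>C. ?P a u"
    proof (cases "C = {}")
      case True then show ?thesis using p by (auto simp: A_def)
    next
      case False
      have bdd: "bdd_below ((\<lambda>q. q x) ` C)" for x
      proof (rule bdd_belowI2)
        fix q assume "q \<in> C"
        then have q: "sublinear q" "q \<le> p" using CA by (auto simp: A_def)
        have "0 = q (x + (- x))" using sublinear_zero[OF q(1)] by simp
        also have "\<dots> \<le> q x + q (- x)" using q(1) unfolding sublinear_def by blast
        also have "\<dots> \<le> q x + p (- x)" using q(2) by (simp add: le_fun_def)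
        finally show "- p (- x) \<le> q x" by simp
      qed
      have le: "(\<lambda>x. INF q\<in>C. q x) \<le> a" if "a \<in> C" for a
        using cINF_lower[OF bdd that] by (auto simp: le_fun_def)
      moreover have "sublinear (\<lambda>x. INF q\<in>C. q x)"
        by (rule sublinear_Inf_chain[OF False _ ch bdd]) (use CA in \<open>auto simp: A_def\<close>)
      moreover have "(\<lambda>x. INF q\<in>C. q x) \<le> p"
      proof -
        obtain a where "a \<in> C" using False by blast
        then show ?thesis using order_trans[OF le[of a], of p] CA by (auto simp: A_def)
      qed
      ultimately show ?thesis unfolding A_def by blast
    qed
  qed
  then obtain q where q: "q \<in> A" "\<And>r. r \<in> A \<Longrightarrow> r \<le> q \<Longrightarrow> r = q" by blast
  then have min: "r = q" if "sublinear r" "r \<le> q" for r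
    using that order_trans[of r q p] by (simp add: A_def)
  have q: "sublinear q" "q \<le> p" using q(1) by (auto simp: A_def)
  have add: "q (x + y) = q x + q y" for x y by (rule minimal_sublinear_additive[OF q(1) min])
  have "q (c *\<^sub>R x) = c * q x" for c x
  proof (cases "c \<ge> 0")
    case True then show ?thesis using q(1) by (simp add: sublinear_def)
  next
    case False
    have "q ((- c) *\<^sub>R x) = (- c) * q x" 
      using q(1) False unfolding sublinear_def by (meson le_cases neg_0_le_iff_le)
    moreover have "q (c *\<^sub>R x) + q ((- c) *\<^sub>R x) = 0"
      using add[of "c *\<^sub>R x" "(- c) *\<^sub>R x"] sublinear_zero[OF q(1)] by simp
    ultimately show ?thesis by simp
  qed
  then have "linear q" using add by (intro linearI) auto
  then show ?thesis using q(2) by (auto simp: le_fun_def)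
qed

lemma convex_on_infdist:
  fixes C :: "'a::real_normed_vector set"
  assumes "convex C" "C \<noteq> {}"
  shows "convex_on UNIV (\<lambda>x. infdist x C)"
proof (intro convex_onI)
  fix t x y assume t: "0 < t" "t < (1::real)"
  show "infdist ((1 - t) *\<^sub>R x + t *\<^sub>R y) C \<le> (1 - t) * infdist x C + t * infdist y C"
  proof (rule field_le_epsilon)
    fix \<epsilon> :: real assume \<epsilon>: "\<epsilon> > 0"
    have "\<exists>c\<in>C. dist u c < infdist u C + \<epsilon>" for u
    proof (rule ccontr)
      assume "\<not> ?thesis"
      then have "infdist u C + \<epsilon> \<le> infdist u C"
        unfolding infdist_notempty[OF assms(2)] 
        by (intro cINF_greatest[OF assms(2)]) (auto simp: not_less)
      then show False using \<epsilon> by simp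
    qed
    then obtain a b where ab: "a \<in> C" "b \<in> C" "dist x a < infdist x C + \<epsilon>" "dist y b < infdist y C + \<epsilon>" by meson
    have "infdist ((1 - t) *\<^sub>R x + t *\<^sub>R y) C \<le> dist ((1 - t) *\<^sub>R x + t *\<^sub>R y) ((1 - t) *\<^sub>R a + t *\<^sub>R b)"
      using ab t assms(1) by (intro infdist_le convexD) auto
    also have "\<dots> = norm ((1 - t) *\<^sub>R (x - a) + t *\<^sub>R (y - b))"
      by (simp add: dist_norm algebra_simps)
    also have "\<dots> \<le> (1 - t) * dist x a + t * dist y b"
      using t by (intro norm_triangle_le) (simp add: dist_norm)
    also have "\<dots> \<le> (1 - t) * (infdist x C + \<epsilon>) + t * (infdist y C + \<epsilon>)"
      using ab t by (intro add_mono mult_left_mono) auto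
    finally show "infdist ((1 - t) *\<^sub>R x + t *\<^sub>R y) C \<le> (1 - t) * infdist x C + t * infdist y C + \<epsilon>"
      by (simp add: algebra_simps)
  qed
qed simp

lemma sublinear_directional_derivative:
  fixes d :: "'a::real_normed_vector \<Rightarrow> real" and x0 :: 'a
  assumes cvx: "convex_on UNIV d" and lip: "\<And>x y. \<bar>d x - d y\<bar> \<le> norm (x - y)"
  defines "p \<equiv> \<lambda>x. INF s\<in>{0<..}. (d (x0 + s *\<^sub>R x) - d x0) / s"
  shows "sublinear p" and "p x \<le> norm x" and "p x \<le> d (x0 + x) - d x0"
proof -
  define Q where "Q x s = (d (x0 + s *\<^sub>R x) - d x0) / s" for x s
  have Qabs: "\<bar>Q x s\<bar> \<le> norm x" if "s > 0" for x s
    using lip[of "x0 + s *\<^sub>R x" x0] that by (simp add: Q_def field_simps)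
  have bdd: "bdd_below (Q x ` {0<..})" for x
  proof (rule bdd_belowI2)
    fix s :: real assume "s \<in> {0<..}"
    then show "- norm x \<le> Q x s" using Qabs[of s x] by auto
  qed
  have p: "p x = (INF s\<in>{0<..}. Q x s)" for x by (simp add: p_def Q_def)
  have ple: "p x \<le> Q x s" if "s > 0" for x s
    unfolding p by (rule cINF_lower[OF bdd]) (use that in simp)
  show "p x \<le> d (x0 + x) - d x0" using ple[of 1 x] by (simp add: Q_def)
  show "p x \<le> norm x" using ple[of 1 x] Qabs[of 1 x] by simp
  have add: "p (x + y) \<le> p x + p y" for x y
  proof -
    have 1: "p (x + y) \<le> Q x s + Q y t" if st: "s > 0" "t > 0" for s t
    proof -
      \<comment> \<open>The harmonic step makes the two given points average to the point wanted.\<close>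
      define r where "r = s * t / (s + t)"
      have "r / s = t / (s + t)" "r / t = s / (s + t)" using st by (auto simp: r_def)
      then have r: "r > 0" "r / s + r / t = 1"
        using st by (auto simp: r_def add.commute simp flip: add_divide_distrib)
      have "x0 + r *\<^sub>R (x + y) = (r / s + r / t) *\<^sub>R x0 + r *\<^sub>R (x + y)" using r by simp
      also have "\<dots> = (r / s) *\<^sub>R (x0 + s *\<^sub>R x) + (r / t) *\<^sub>R (x0 + t *\<^sub>R y)"
        using st by (simp add: scaleR_add_right scaleR_add_left)
      finally have eq: "x0 + r *\<^sub>R (x + y) = (r / s) *\<^sub>R (x0 + s *\<^sub>R x) + (r / t) *\<^sub>R (x0 + t *\<^sub>R y)" .
      have "d (x0 + r *\<^sub>R (x + y)) \<le> (r / s) * d (x0 + s *\<^sub>R x) + (r / t) * d (x0 + t *\<^sub>R y)"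
      proof -
        have "0 \<le> r / s" "0 \<le> r / t" using r st by auto
        then show ?thesis unfolding eq using cvx r(2) unfolding convex_on_def by blast
      qed
      also have "\<dots> = (r / s) * (s * Q x s) + (r / t) * (t * Q y t) + (r / s + r / t) * d x0"
        using st by (simp add: Q_def field_simps)
      also have "\<dots> = r * (Q x s + Q y t) + d x0"
        unfolding r(2) using st by (simp add: algebra_simps)
      finally have "Q (x + y) r \<le> Q x s + Q y t" using r(1) by (simp add: Q_def field_simps)
      then show ?thesis using ple[OF r(1), of "x + y"] by simp
    qed
    have "p (x + y) - Q y t \<le> p x" if "t > 0" for t
      unfolding p[of x] by (rule cINF_greatest) (use 1 that in \<open>auto simp: algebra_simps\<close>)
    then have "p (x + y) - p x \<le> p y"
      unfolding p[of y] by (intro cINF_greatest) (auto simp: algebra_simps)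
    then show ?thesis by simp
  qed
  have scale: "p (c *\<^sub>R x) \<le> c * p x" if c: "c > 0" for c x
  proof -
    have "p (c *\<^sub>R x) / c \<le> Q x s" if s: "s > 0" for s
    proof -
      have "p (c *\<^sub>R x) \<le> Q (c *\<^sub>R x) (s / c)" using c s by (intro ple) simp
      also have "\<dots> = c * Q x s" using c s by (simp add: Q_def field_simps)
      finally show ?thesis using c by (simp add: field_simps)
    qed
    then have "p (c *\<^sub>R x) / c \<le> p x" unfolding p[of x] by (intro cINF_greatest) auto
    then show ?thesis using c by (simp add: field_simps)
  qed
  have "p 0 = 0" by (simp add: p_def)
  then show "sublinear p" unfolding sublinear_def
    using add sublinear_scaleI[of p, OF _ scale] by blast
qed

text \<open>
  The directional derivative of \<open>d\<close> at \<open>x0\<close> is sublinear, and a linear functional below it is a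
  subgradient. The Lipschitz bound makes the subgradient continuous.
\<close>

lemma supporting_functional:
  fixes d :: "'a::real_normed_vector \<Rightarrow> real"
  assumes "convex_on UNIV d" and "\<And>x y. \<bar>d x - d y\<bar> \<le> norm (x - y)"
  obtains \<phi> where "bounded_linear \<phi>" "\<And>x. \<phi> (x - x0) \<le> d x - d x0"
proof -
  note p = sublinear_directional_derivative[OF assms, where ?x0.0 = x0]
  obtain \<phi> where \<phi>: "linear \<phi>" "\<And>x. \<phi> x \<le> (INF s\<in>{0<..}. (d (x0 + s *\<^sub>R x) - d x0) / s)"
    using sublinear_dominates_linear[OF p(1)] by blast
  have le: "\<phi> x \<le> norm x" "\<phi> x \<le> d (x0 + x) - d x0" for x
    using order_trans[OF \<phi>(2) p(2)] order_trans[OF \<phi>(2) p(3)] by auto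
  have "\<bar>\<phi> x\<bar> \<le> norm x" for x
    using le(1)[of x] le(1)[of "- x"] linear_neg[OF \<phi>(1), of x] by auto
  then have "bounded_linear \<phi>" using \<phi>(1)
    by (intro bounded_linear_intro[of _ 1]) (auto simp: linear_add linear_scale)
  then show ?thesis using le(2)[of "_ - x0"] by (intro that) auto
qed

text \<open>
  A real linear map on the complex plane is complex linear iff it has the form \<open>h \<mapsto> h v\<close>.
\<close>

definition disc_holomorphic :: "(complex \<Rightarrow> 'a::complex_normed_vector) \<Rightarrow> bool" where
  "disc_holomorphic g \<longleftrightarrow> (\<forall>\<zeta>\<in>ball 0 1. \<exists>v. (g has_derivative (\<lambda>h. h *\<^sub>C v)) (at \<zeta>))"

text \<open>
  A subgradient \<open>\<phi>\<close> of the distance from \<open>C\<close> at \<open>g \<mu>\<close> is the real part of a complex linear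
  functional \<open>L\<close>, and the scalar function \<open>L \<circ> g\<close> is holomorphic. On the circle its real part exceeds
  the value at \<open>\<mu>\<close> by at most \<open>\<epsilon> - dist (g \<mu>) C\<close>, so this number cannot be negative.
\<close>

lemma maximum_principle_infdist:
  fixes g :: "complex \<Rightarrow> 'a::complex_normed_vector"
  assumes hol: "disc_holomorphic g" and cont: "continuous_on (cball 0 1) g"
    and C: "convex C" "C \<noteq> {}" and bd: "\<And>\<zeta>. cmod \<zeta> = 1 \<Longrightarrow> infdist (g \<zeta>) C \<le> \<epsilon>"
    and \<mu>: "cmod \<mu> \<le> 1"
  shows "infdist (g \<mu>) C \<le> \<epsilon>"
proof -
  define d where "d x = infdist x C" for x
  have "\<bar>d x - d y\<bar> \<le> norm (x - y)" for x y
    using infdist_triangle_abs[of x C y] by (simp add: d_def dist_norm)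
  moreover have "convex_on UNIV d" unfolding d_def[abs_def] by (rule convex_on_infdist[OF C])
  ultimately obtain \<phi> where \<phi>: "bounded_linear \<phi>" "\<And>x. \<phi> (x - g \<mu>) \<le> d x - d (g \<mu>)"
    using supporting_functional[of d "g \<mu>"] by blast
  note lin = linear_add[OF bounded_linear.linear[OF \<phi>(1)]] linear_diff[OF bounded_linear.linear[OF \<phi>(1)]]
    linear_scale[OF bounded_linear.linear[OF \<phi>(1)]] linear_neg[OF bounded_linear.linear[OF \<phi>(1)]]
  \<comment> \<open>The complex linear functional with real part \<open>\<phi>\<close>.\<close>
  define L where "L x = complex_of_real (\<phi> x) - \<i> * complex_of_real (\<phi> (\<i> *\<^sub>C x))" for x
  have L: "bounded_linear L" unfolding L_def
    by (intro bounded_linear_sub bounded_linear_const_mult bounded_linear_compose[OF bounded_linear_of_real]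
       \<phi>(1) bounded_linear_compose[OF \<phi>(1) bounded_linear_scaleC])
  have LC: "L (c *\<^sub>C x) = c * L x" for c x
  proof -
    have dec: "c = of_real (Re c) + of_real (Im c) * \<i>" by (simp add: complex_eq_iff)
    have c: "c *\<^sub>C x = Re c *\<^sub>R x + Im c *\<^sub>R (\<i> *\<^sub>C x)"
      by (subst dec) (simp only: scaleC_add_left scaleC_of_real scaleC_scaleC[symmetric])
    have ii: "\<i> *\<^sub>C \<i> *\<^sub>C x = - x" by (simp add: scaleC_scaleC scaleC_minus_one)
    have ci: "\<i> *\<^sub>C (c *\<^sub>C x) = Re c *\<^sub>R (\<i> *\<^sub>C x) - Im c *\<^sub>R x"
      unfolding c by (simp add: scaleC_add_right scaleC_scaleR ii)
    show ?thesis unfolding L_def ci unfolding c lin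
      by (simp add: complex_eq_iff lin)
  qed
  have "Re (L (g \<mu>)) \<le> \<phi> (g \<mu>) + (\<epsilon> - d (g \<mu>))"
  proof (rule maximum_real_frontier[of "\<lambda>\<zeta>. L (g \<zeta>)" "cball 0 1"])
    show "(\<lambda>\<zeta>. L (g \<zeta>)) holomorphic_on interior (cball 0 1)"
    proof (subst holomorphic_on_open, simp, intro ballI)
      fix \<zeta> :: complex assume "\<zeta> \<in> interior (cball 0 1)"
      then have "\<zeta> \<in> ball 0 1" by simp
      then obtain v where "(g has_derivative (\<lambda>h. h *\<^sub>C v)) (at \<zeta>)"
        using hol unfolding disc_holomorphic_def by blast
      then have "((\<lambda>\<zeta>. L (g \<zeta>)) has_derivative (\<lambda>h. L (h *\<^sub>C v))) (at \<zeta>)"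
        by (rule bounded_linear.has_derivative[OF L])
      moreover have "(\<lambda>h. L (h *\<^sub>C v)) = (*) (L v)" by (simp add: fun_eq_iff LC mult.commute)
      ultimately show "\<exists>f'. ((\<lambda>\<zeta>. L (g \<zeta>)) has_field_derivative f') (at \<zeta>)"
        by (auto simp: has_field_derivative_def)
    qed
    show "continuous_on (closure (cball 0 1)) (\<lambda>\<zeta>. L (g \<zeta>))"
      using bounded_linear.continuous_on[OF L cont] by simp
    show "Re (L (g \<zeta>)) \<le> \<phi> (g \<mu>) + (\<epsilon> - d (g \<mu>))" if "\<zeta> \<in> frontier (cball 0 1)" for \<zeta>
      using \<phi>(2)[of "g \<zeta>"] bd[of \<zeta>] that by (auto simp: L_def lin d_def)
  qed (use \<mu> in auto)
  then show ?thesis by (simp add: L_def d_def)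
qed

section \<open>The exponential of a small operator\<close>

lemma unit_interval_increment_le:
  fixes u :: "real \<Rightarrow> 'a::real_normed_vector"
  assumes u: "\<And>s. s \<in> {0..1} \<Longrightarrow> (u has_vector_derivative u' s) (at s within {0..1})"
    and bd: "\<And>s. s \<in> {0..1} \<Longrightarrow> norm (u' s) \<le> M" and t: "t \<in> {0..1}"
  shows "norm (u t - u 0) \<le> M"
proof -
  have "norm (u t - u 0) \<le> M * norm (t - 0)"
  proof (rule differentiable_bound[of "{0..1}" u "\<lambda>s h. h *\<^sub>R u' s"])
    show "(u has_derivative (\<lambda>h. h *\<^sub>R u' s)) (at s within {0..1})" if "s \<in> {0..1}" for s
      using u[OF that] by (simp add: has_vector_derivative_def)
    show "onorm (\<lambda>h. h *\<^sub>R u' s) \<le> M" if "s \<in> {0..1}" for s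
      using bd[OF that] by (intro onorm_le) (simp add: mult.commute[of M] mult_left_mono)
  qed (use t in auto)
  also have "\<dots> \<le> M * 1"
    using t bd[OF t] norm_ge_zero[of "u' t"] by (intro mult_left_mono) (auto simp del: norm_ge_zero)
  finally show ?thesis by simp
qed

text \<open>
  The operator \<open>exp (t T)\<close>. Everything below about it is read off the differential equation
  \<open>u' = T u\<close> on the unit interval. Operators of norm at most \<open>1/2\<close> suffice for the small steps of
  the Euler scheme, and for them the solutions are controlled by a single mean value estimate.
\<close>

definition linear_flow :: "('a::real_normed_vector \<Rightarrow> 'a) \<Rightarrow> real \<Rightarrow> 'a \<Rightarrow> 'a" where
  "linear_flow T t x = (\<Sum>n. (t ^ n / fact n) *\<^sub>R (T ^^ n) x)"

lemma linear_flow_zero [simp]: "linear_flow T 0 x = x"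
proof -
  have "(\<lambda>n. (0 ^ n / fact n) *\<^sub>R (T ^^ n) x) = (\<lambda>n. if n = 0 then x else 0)"
    by (auto simp: fun_eq_iff)
  then show ?thesis unfolding linear_flow_def using sums_single[of 0 "\<lambda>_. x"] by (metis sums_unique)
qed

text \<open>
  Termwise differentiation shifts the series by one place, and the terms of the differentiated
  series are the images under \<open>T\<close> of the original ones.
\<close>

lemma linear_flow_has_vector_derivative:
  fixes T :: "'a::banach \<Rightarrow> 'a"
  assumes T: "bounded_linear T" and K: "\<And>x. norm (T x) \<le> K * norm x" and t: "t \<in> {0..1}"
  shows "((\<lambda>t. linear_flow T t x) has_vector_derivative T (linear_flow T t x)) (at t within {0..1})"
proof -
  interpret T: bounded_linear T by (rule T)
  define f where "f n t = (t ^ n / fact n) *\<^sub>R (T ^^ n) x" for n and t :: real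
  define f' where "f' n t = (case n of 0 \<Rightarrow> 0 | Suc k \<Rightarrow> T (f k t))" for n t
  define S where "S t = linear_flow T t x" for t
  define \<kappa> where "\<kappa> = \<bar>K\<bar> + 1"
  have \<kappa>: "\<kappa> > 0" "norm (T y) \<le> \<kappa> * norm y" for y
    using K[of y] by (auto simp: \<kappa>_def intro!: order_trans[OF K] mult_right_mono)
  have pow: "norm ((T ^^ n) x) \<le> \<kappa> ^ n * norm x" for n
  proof (induction n)
    case (Suc n)
    have "norm ((T ^^ Suc n) x) \<le> \<kappa> * norm ((T ^^ n) x)" using \<kappa>(2) by simp
    also have "\<dots> \<le> \<kappa> * (\<kappa> ^ n * norm x)" using Suc \<kappa>(1) by (intro mult_left_mono) auto
    finally show ?case by (simp add: mult.assoc)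
  qed simp
  have "norm (f n s) \<le> \<kappa> ^ n /\<^sub>R fact n * norm x" if "s \<in> {0..1}" for n s
  proof -
    have "norm (f n s) = \<bar>s\<bar> ^ n / fact n * norm ((T ^^ n) x)" by (simp add: f_def power_abs)
    also have "\<dots> \<le> 1 / fact n * (\<kappa> ^ n * norm x)"
      using that pow by (intro mult_mono divide_right_mono power_le_one) auto
    finally show ?thesis by (simp add: field_simps)
  qed
  moreover have "summable (\<lambda>n. \<kappa> ^ n /\<^sub>R fact n * norm x)"
    by (intro summable_mult2 summable_exp_generic)
  ultimately have unif: "uniform_limit {0..1} (\<lambda>n s. \<Sum>i<n. f i s) (\<lambda>s. \<Sum>i. f i s) sequentially"
    by (rule Weierstrass_m_test)
  have Sdef: "S = (\<lambda>s. \<Sum>i. f i s)" by (simp add: S_def[abs_def] linear_flow_def f_def)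
  have sums: "(\<lambda>n. f n s) sums S s" if "s \<in> {0..1}" for s
    using tendsto_uniform_limitI[OF unif that] by (simp add: sums_def Sdef)
  have "\<exists>g. \<forall>s\<in>{0..1}. (\<lambda>n. f n s) sums (g s) \<and> (g has_derivative (\<lambda>h. h *\<^sub>R T (S s))) (at s within {0..1})"
  proof (rule has_derivative_series[where f' = "\<lambda>n s h. h *\<^sub>R f' n s"])
    show "(f n has_derivative (\<lambda>h. h *\<^sub>R f' n s)) (at s within {0..1})" if "s \<in> {0..1}" for n s
    proof (cases n)
      case 0
      then show ?thesis by (simp add: f_def[abs_def] f'_def)
    next
      case (Suc k)
      have "((\<lambda>t. t ^ Suc k / fact (Suc k)) has_vector_derivative (s ^ k / fact k)) (at s within {0..1})"
        using DERIV_cdivide[OF DERIV_pow[of "Suc k" s], of "fact (Suc k)" "{0..1}"]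
        by (simp add: has_real_derivative_iff_has_vector_derivative del: power_Suc of_nat_Suc)
      then have "((\<lambda>t. (t ^ Suc k / fact (Suc k)) *\<^sub>R (T ^^ Suc k) x) has_vector_derivative (s ^ k / fact k) *\<^sub>R (T ^^ Suc k) x) (at s within {0..1})"
        by (rule bounded_linear.has_vector_derivative[OF bounded_linear_scaleR_left])
      then show ?thesis unfolding has_vector_derivative_def f_def[abs_def] Suc
        by (simp add: f'_def f_def T.scaleR)
    qed
    show "\<forall>\<^sub>F n in sequentially. \<forall>s\<in>{0..1}. \<forall>h. norm ((\<Sum>i<n. h *\<^sub>R f' i s) - h *\<^sub>R T (S s)) \<le> e * norm h"
      if e: "e > 0" for e
    \<comment> \<open>One extra term absorbs the shift: the \<open>(n + 1)\<close>-st partial sum of the derivatives is the image of the \<open>n\<close>-th partial sum.\<close>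
    proof (subst eventually_sequentially_Suc[symmetric])
      have "\<forall>\<^sub>F n in sequentially. \<forall>s\<in>{0..1}. dist (\<Sum>i<n. f i s) (S s) < e / \<kappa>"
        using unif e \<kappa> unfolding Sdef by (intro uniform_limitD) auto
      then show "\<forall>\<^sub>F n in sequentially. \<forall>s\<in>{0..1}. \<forall>h. norm ((\<Sum>i<Suc n. h *\<^sub>R f' i s) - h *\<^sub>R T (S s)) \<le> e * norm h"
      proof (eventually_elim, intro ballI allI)
        fix n :: nat and s h :: real
        assume *: "\<forall>s\<in>{0..1}. dist (\<Sum>i<n. f i s) (S s) < e / \<kappa>" and s: "s \<in> {0..1}"
        have "(\<Sum>i<Suc n. h *\<^sub>R f' i s) - h *\<^sub>R T (S s) = h *\<^sub>R T ((\<Sum>i<n. f i s) - S s)"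
          by (simp only: sum.lessThan_Suc_shift) 
             (simp add: f'_def T.diff T.sum scaleR_diff_right scaleR_sum_right)
        then have "norm ((\<Sum>i<Suc n. h *\<^sub>R f' i s) - h *\<^sub>R T (S s)) = \<bar>h\<bar> * norm (T ((\<Sum>i<n. f i s) - S s))"
          by simp
        also have "\<dots> \<le> \<bar>h\<bar> * (\<kappa> * (e / \<kappa>))"
          using * s \<kappa> by (intro mult_left_mono order_trans[OF \<kappa>(2)]) (auto simp: dist_norm less_imp_le)
        finally show "norm ((\<Sum>i<Suc n. h *\<^sub>R f' i s) - h *\<^sub>R T (S s)) \<le> e * norm h"
          using \<kappa> by (simp add: mult.commute)
      qed
    qed
    show "(\<lambda>n. f n 0) sums S 0" by (rule sums) simp
  qed auto
  then obtain g where g: "\<And>s. s \<in> {0..1} \<Longrightarrow> (\<lambda>n. f n s) sums (g s)"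
      "\<And>s. s \<in> {0..1} \<Longrightarrow> (g has_derivative (\<lambda>h. h *\<^sub>R T (S s))) (at s within {0..1})" by blast
  have gS: "g s = S s" if "s \<in> {0..1}" for s using sums_unique2[OF g(1) sums] that by blast
  have "(S has_derivative (\<lambda>h. h *\<^sub>R T (S t))) (at t within {0..1})"
    by (rule has_derivative_transform[OF t gS[symmetric] g(2)[OF t]])
  then show ?thesis by (simp add: has_vector_derivative_def S_def[abs_def])
qed

context
  fixes T :: "'a::banach \<Rightarrow> 'a" and K :: real
  assumes T: "bounded_linear T" and K: "\<And>x. norm (T x) \<le> K * norm x" "0 \<le> K" "K \<le> 1/2"
begin

text \<open>
  At a point where \<open>\<parallel>u\<parallel>\<close> is maximal the increment from \<open>u 0\<close> is at most half of that maximum.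
\<close>

lemma small_linear_ode_bound:
  assumes u: "\<And>t. t \<in> {0..1} \<Longrightarrow> (u has_vector_derivative T (u t)) (at t within {0..1})"
    and t: "t \<in> {0..1}"
  shows "norm (u t) \<le> 2 * norm (u 0)"
proof -
  have "continuous_on {0..1} u" using u by (rule continuous_on_vector_derivative)
  then have "continuous_on {0..1} (\<lambda>t. norm (u t))" by (rule continuous_on_norm)
  then obtain s where s: "s \<in> {0..1}" and max: "\<And>t. t \<in> {0..1} \<Longrightarrow> norm (u t) \<le> norm (u s)"
    using continuous_attains_sup[of "{0..1::real}" "\<lambda>t. norm (u t)"] by auto
  have "norm (u s - u 0) \<le> K * norm (u s)"
    using max K by (intro unit_interval_increment_le[OF u _ s] order_trans[OF K(1)] mult_left_mono) auto
  also have "\<dots> \<le> 1/2 * norm (u s)" using K by (intro mult_right_mono) auto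
  finally have "norm (u s) \<le> 2 * norm (u 0)" using norm_triangle_ineq2[of "u s" "u 0"] by simp
  then show ?thesis using max[OF t] by simp
qed

lemma small_linear_ode_unique:
  assumes u: "\<And>t. t \<in> {0..1} \<Longrightarrow> (u has_vector_derivative T (u t)) (at t within {0..1})"
    and v: "\<And>t. t \<in> {0..1} \<Longrightarrow> (v has_vector_derivative T (v t)) (at t within {0..1})"
    and "u 0 = v 0" and t: "t \<in> {0..1}"
  shows "u t = v t"
proof -
  have "norm (u t - v t) \<le> 2 * norm (u 0 - v 0)"
  proof (rule small_linear_ode_bound[OF _ t, of "\<lambda>t. u t - v t"])
    show "((\<lambda>t. u t - v t) has_vector_derivative T (u s - v s)) (at s within {0..1})" if "s \<in> {0..1}" for s
      using has_vector_derivative_diff[OF u[OF that] v[OF that]] 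
      by (simp add: linear_diff[OF bounded_linear.linear[OF T]])
  qed
  then show ?thesis using \<open>u 0 = v 0\<close> by simp
qed

text \<open>
  Both \<open>u t - x\<close> and \<open>u t - x - t T x\<close> are estimated by their derivatives \<open>T (u t)\<close> and
  \<open>T (u t - x)\<close>; each use of \<open>T\<close> contributes a factor \<open>K\<close>.
\<close>

lemma linear_flow_first_order: "norm (linear_flow T 1 x - x - T x) \<le> 2 * K\<^sup>2 * norm x"
proof -
  interpret T: bounded_linear T by (rule T)
  let ?u = "\<lambda>t. linear_flow T t x"
  note u = linear_flow_has_vector_derivative[OF T K(1), of _ x]
  have u2: "norm (?u t) \<le> 2 * norm x" if "t \<in> {0..1}" for t
    using small_linear_ode_bound[OF u that] by simp
  have "norm (T (?u t)) \<le> K * (2 * norm x)" if "t \<in> {0..1}" for t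
    using u2[OF that] K by (intro order_trans[OF K(1)] mult_left_mono) auto
  then have u1: "norm (?u t - x) \<le> K * (2 * norm x)" if "t \<in> {0..1}" for t
    using unit_interval_increment_le[OF u _ that, of "K * (2 * norm x)"] by simp
  define w where "w t = ?u t - t *\<^sub>R T x" for t
  have "(w has_vector_derivative T (?u t - x)) (at t within {0..1})" if "t \<in> {0..1}" for t
    unfolding w_def[abs_def] using u[OF that]
    by (auto intro!: derivative_eq_intros simp: T.diff)
  moreover have "norm (T (?u t - x)) \<le> K * (K * (2 * norm x))" if "t \<in> {0..1}" for t
    using u1[OF that] K by (intro order_trans[OF K(1)] mult_left_mono) auto
  ultimately have "norm (w 1 - w 0) \<le> K * (K * (2 * norm x))"
    by (rule unit_interval_increment_le) auto
  then show ?thesis by (simp add: w_def power2_eq_square algebra_simps)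
qed

lemma linear_linear_flow: "linear (linear_flow T 1)"
proof -
  interpret T: bounded_linear T by (rule T)
  note u = linear_flow_has_vector_derivative[OF T K(1)]
  show ?thesis
  proof (rule linearI)
    fix x y c
    show "linear_flow T 1 (x + y) = linear_flow T 1 x + linear_flow T 1 y"
    proof (rule small_linear_ode_unique[of "\<lambda>t. linear_flow T t (x + y)" "\<lambda>t. linear_flow T t x + linear_flow T t y"])
      show "((\<lambda>t. linear_flow T t x + linear_flow T t y) has_vector_derivative T (linear_flow T t x + linear_flow T t y)) (at t within {0..1})"
        if "t \<in> {0..1}" for t
        unfolding T.add by (intro has_vector_derivative_add u that)
    qed (use u in auto)
    show "linear_flow T 1 (c *\<^sub>R x) = c *\<^sub>R linear_flow T 1 x"
    proof (rule small_linear_ode_unique[of "\<lambda>t. linear_flow T t (c *\<^sub>R x)" "\<lambda>t. c *\<^sub>R linear_flow T t x"])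
      show "((\<lambda>t. c *\<^sub>R linear_flow T t x) has_vector_derivative T (c *\<^sub>R linear_flow T t x)) (at t within {0..1})"
        if "t \<in> {0..1}" for t
        unfolding T.scaleR by (rule bounded_linear.has_vector_derivative[OF bounded_linear_scaleR_right u[OF that]])
    qed (use u in auto)
  qed
qed

end

text \<open>
  Run backwards, the flow of \<open>T\<close> solves the equation of \<open>- T\<close>.
\<close>

lemma linear_flow_inverse:
  fixes T :: "'a::banach \<Rightarrow> 'a"
  assumes T: "bounded_linear T" and K: "\<And>x. norm (T x) \<le> K * norm x" "0 \<le> K" "K \<le> 1/2"
  shows "linear_flow (\<lambda>x. - T x) 1 (linear_flow T 1 x) = x"
proof -
  have mT: "bounded_linear (\<lambda>x. - T x)" using T by (rule bounded_linear_minus)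
  have mK: "norm (- T x) \<le> K * norm x" for x using K(1) by simp
  have "linear_flow (\<lambda>x. - T x) 1 (linear_flow T 1 x) = linear_flow T (1 - 1) x"
  proof (rule small_linear_ode_unique[OF mT mK K(2,3), 
        of "\<lambda>t. linear_flow (\<lambda>x. - T x) t (linear_flow T 1 x)" "\<lambda>t. linear_flow T (1 - t) x"])
    show "((\<lambda>s. linear_flow (\<lambda>x. - T x) s (linear_flow T 1 x)) has_vector_derivative
        - T (linear_flow (\<lambda>x. - T x) t (linear_flow T 1 x))) (at t within {0..1})"
      if "t \<in> {0..1}" for t
      by (rule linear_flow_has_vector_derivative[OF mT mK that])
    show "((\<lambda>t. linear_flow T (1 - t) x) has_vector_derivative - T (linear_flow T (1 - t) x)) (at t within {0..1})"
      if t: "t \<in> {0..1}" for t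
    proof -
      have "((\<lambda>t. linear_flow T t x) has_vector_derivative T (linear_flow T (1 - t) x)) (at (1 - t) within (\<lambda>t. 1 - t) ` {0..1})"
        using linear_flow_has_vector_derivative[OF T K(1), of "1 - t" x] t by (simp add: image_diff_atLeastAtMost)
      moreover have "((\<lambda>t::real. 1 - t) has_vector_derivative -1) (at t within {0..1})"
        by (auto intro!: derivative_eq_intros)
      ultimately show ?thesis
        using vector_diff_chain_within[of "\<lambda>t. 1 - t" "-1" t "{0..1}" "\<lambda>t. linear_flow T t x"] by (simp add: o_def)
    qed
  qed auto
  then show ?thesis by simp
qed

section \<open>Boundedness of the triple product\<close>

context jbstar_triple
begin

lemma triple_add_left: "triple (x + y) u z = triple x u z + triple y u z"
  using clinear_outer by (simp add: clinear_def)
lemma triple_add_right: "triple z u (x + y) = triple z u x + triple z u y"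
  by (metis triple_add_left symmetric_outer)
lemma triple_add_middle: "triple u (x + y) z = triple u x z + triple u y z"
  using antilinear_inner by (simp add: antilinear_def)
lemma triple_scaleC_left: "triple (c *\<^sub>C x) u z = c *\<^sub>C triple x u z"
  using clinear_outer by (simp add: clinear_def)
lemma triple_scaleC_right: "triple z u (c *\<^sub>C x) = c *\<^sub>C triple z u x"
  by (metis triple_scaleC_left symmetric_outer)
lemma triple_scaleC_middle: "triple u (c *\<^sub>C x) z = cnj c *\<^sub>C triple u x z"
  using antilinear_inner by (simp add: antilinear_def)

lemma triple_scaleR_left: "triple (r *\<^sub>R x) u z = r *\<^sub>R triple x u z"
  using triple_scaleC_left[of "of_real r" x] by (simp add: scaleC_of_real)
lemma triple_scaleR_right: "triple z u (r *\<^sub>R x) = r *\<^sub>R triple z u x"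
  using triple_scaleC_right[of _ _ "of_real r" x] by (simp add: scaleC_of_real)
lemma triple_scaleR_middle: "triple u (r *\<^sub>R x) z = r *\<^sub>R triple u x z"
  using triple_scaleC_middle[of _ "of_real r" x] by (simp add: scaleC_of_real)

lemma triple_zero [simp]: "triple 0 y z = 0" "triple x 0 z = 0" "triple x y 0 = 0"
  using triple_scaleR_left[of 0] triple_scaleR_middle[of _ 0] triple_scaleR_right[of _ _ 0] by simp_all

lemma triple_minus [simp]: "triple (- x) y z = - triple x y z" "triple x (- y) z = - triple x y z" 
    "triple x y (- z) = - triple x y z"
  using triple_scaleR_left[of "-1"] triple_scaleR_middle[of _ "-1"] triple_scaleR_right[of _ _ "-1"] by simp_all

lemma triple_diff_left: "triple (x - y) u z = triple x u z - triple y u z"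
  using triple_add_left[of x "- y"] by simp
lemma triple_diff_middle: "triple u (x - y) z = triple u x z - triple u y z"
  using triple_add_middle[of u x "- y"] by simp
lemma triple_diff_right: "triple z u (x - y) = triple z u x - triple z u y"
  using triple_add_right[of z u x "- y"] by simp

lemmas triple_linear = triple_add_left triple_add_middle triple_add_right
  triple_diff_left triple_diff_middle triple_diff_right
  triple_scaleR_left triple_scaleR_middle triple_scaleR_right

lemma bounded_linear_box_self: "bounded_linear (triple x x)"
  using hermitian_box[of x] by (simp add: hermitian_operator_def bounded_clinear_def)

lemma norm_triple_self_le: "norm (triple x x z) \<le> (norm x)\<^sup>2 * norm z"
  using onorm[OF bounded_linear_box_self, of x z] by (simp add: onorm_box)

text \<open>
  Polarization over the fourth roots of unity expresses \<open>x \<box> y\<close> by operators of the form \<open>w \<box> w\<close>,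
  whose norms are known.
\<close>

lemma norm_triple_polarized: "norm (triple x y z) \<le> (norm x + norm y)\<^sup>2 * norm z"
proof -
  let ?q = "\<lambda>u. triple (x + u *\<^sub>C y) (x + u *\<^sub>C y) z"
  have q: "?q u = triple x x z + cnj u *\<^sub>C triple x y z + u *\<^sub>C triple y x z + (u * cnj u) *\<^sub>C triple y y z" for u
    by (simp add: triple_add_left triple_add_middle triple_scaleC_left triple_scaleC_middle scaleC_scaleC
        scaleC_add_right algebra_simps)
  have ii: "\<i> *\<^sub>C \<i> *\<^sub>C w = - w" for w :: 'z by (simp add: scaleC_scaleC scaleC_minus_one)
  have s1: "1 *\<^sub>C w = w" for w :: 'z using scaleC_of_real[of 1 w] by simp
  have smi: "(- c) *\<^sub>C w = - (c *\<^sub>C w)" for c and w :: 'z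
    by (metis scaleC_scaleC scaleC_minus_one mult_minus1)
  have scm: "c *\<^sub>C (- w) = - (c *\<^sub>C w)" for c and w :: 'z
    by (metis scaleC_scaleC scaleC_minus_one mult_minus1 mult.commute)
  have four: "4 *\<^sub>R w = w + (w + (w + w))" for w :: 'z
    using scaleR_add_left[of 2 2 w] by (simp add: scaleR_2 add.assoc)
  have "?q 1 + \<i> *\<^sub>C ?q \<i> - ?q (-1) - \<i> *\<^sub>C ?q (- \<i>) = 4 *\<^sub>R triple x y z"
    unfolding q by (simp add: scaleC_add_right scaleC_diff_right smi scm ii s1 scaleC_minus_one)
      (simp add: algebra_simps four)
  then have "4 * norm (triple x y z) = norm (?q 1 + \<i> *\<^sub>C ?q \<i> - ?q (-1) - \<i> *\<^sub>C ?q (- \<i>))" 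
    by simp
  also have "\<dots> \<le> norm (?q 1) + norm (\<i> *\<^sub>C ?q \<i>) + norm (?q (-1)) + norm (\<i> *\<^sub>C ?q (- \<i>))"
    by (intro norm_triangle_le norm_triangle_le_diff add_mono) auto
  also have "\<dots> = norm (?q 1) + norm (?q \<i>) + norm (?q (-1)) + norm (?q (- \<i>))"
    by (simp add: norm_scaleC)
  also have "\<dots> \<le> 4 * ((norm x + norm y)\<^sup>2 * norm z)"
  proof -
    have "norm (?q u) \<le> (norm x + norm y)\<^sup>2 * norm z" if "cmod u = 1" for u
    proof -
      have "norm (x + u *\<^sub>C y) \<le> norm x + norm y"
        using norm_triangle_ineq[of x "u *\<^sub>C y"] that by (simp add: norm_scaleC)
      then have "(norm (x + u *\<^sub>C y))\<^sup>2 \<le> (norm x + norm y)\<^sup>2" by (intro power_mono) auto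
      then show ?thesis by (intro order_trans[OF norm_triple_self_le] mult_right_mono) auto
    qed
    from this[of 1] this[of \<i>] this[of "-1"] this[of "-\<i>"] show ?thesis by simp
  qed
  finally show ?thesis by simp
qed

lemma norm_triple_le: "norm (triple x y z) \<le> 4 * norm x * norm y * norm z"
proof (cases "x = 0 \<or> y = 0")
  case False
  let ?x = "x /\<^sub>R norm x" and ?y = "y /\<^sub>R norm y"
  have "norm (triple x y z) = norm x * norm y * norm (triple ?x ?y z)"
    using False by (simp add: triple_scaleR_left triple_scaleR_middle field_simps)
  also have "\<dots> \<le> norm x * norm y * ((norm ?x + norm ?y)\<^sup>2 * norm z)"
    by (intro mult_left_mono norm_triple_polarized) simp
  also have "\<dots> = 4 * norm x * norm y * norm z" using False by simp
  finally show ?thesis .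
qed auto

lemma bounded_linear_triple:
  "bounded_linear (\<lambda>x. triple x y z)" "bounded_linear (\<lambda>y. triple x y z)" "bounded_linear (\<lambda>z. triple x y z)"
  by (rule bounded_linear_intro[of _ "4 * norm y * norm z"]; simp add: triple_linear order_trans[OF norm_triple_le] mult_ac)
     (rule bounded_linear_intro[of _ "4 * norm x * norm z"] bounded_linear_intro[of _ "4 * norm x * norm y"]; 
       simp add: triple_linear order_trans[OF norm_triple_le] mult_ac)+

text \<open>
  As a continuous bilinear map into the bounded operators, \<open>box\<close> gives access to the product rules
  for bilinear maps; the triple product is the composition of two of them.
\<close>

definition box :: "'z \<Rightarrow> 'z \<Rightarrow> 'z \<Rightarrow>\<^sub>L 'z" where "box x y = Blinfun (triple x y)"

lemma box_apply [simp]: "blinfun_apply (box x y) z = triple x y z"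
  by (simp add: box_def bounded_linear_Blinfun_apply[OF bounded_linear_triple(3)])

lemma bounded_bilinear_box: "bounded_bilinear box"
proof
  show "\<exists>K. \<forall>a b. norm (box a b) \<le> norm a * norm b * K"
  proof (intro exI allI norm_blinfun_bound)
    fix a b x show "norm (blinfun_apply (box a b) x) \<le> norm a * norm b * 4 * norm x"
      using norm_triple_le[of a b x] by (simp add: mult_ac)
  qed simp
qed (auto intro!: blinfun_eqI simp: triple_linear blinfun.add_left blinfun.scaleR_left)

lemma has_vector_derivative_triple:
  assumes "(u has_vector_derivative u') (at t within S)" "(v has_vector_derivative v') (at t within S)"
    "(w has_vector_derivative w') (at t within S)"
  shows "((\<lambda>t. triple (u t) (v t) (w t)) has_vector_derivative
     triple u' (v t) (w t) + triple (u t) v' (w t) + triple (u t) (v t) w') (at t within S)"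
  using bounded_bilinear.has_vector_derivative[OF bounded_bilinear_blinfun_apply
      bounded_bilinear.has_vector_derivative[OF bounded_bilinear_box assms(1,2)] assms(3)]
  by (simp add: blinfun.add_left add_ac)

lemma continuous_on_triple [continuous_intros]:
  assumes "continuous_on S u" "continuous_on S v" "continuous_on S w"
  shows "continuous_on S (\<lambda>t. triple (u t) (v t) (w t))"
  using bounded_bilinear.continuous_on[OF bounded_bilinear_blinfun_apply
      bounded_bilinear.continuous_on[OF bounded_bilinear_box assms(1,2)] assms(3)] by simp

section \<open>Peirce calculus of a tripotent\<close>

lemma scaleR_three_cancel: "x + x + x = y + y + y \<Longrightarrow> x = (y::'a::real_vector)"
  using scaleR_add_left[of 1 1 x] scaleR_add_left[of 2 1 x] scaleR_add_left[of 1 1 y] scaleR_add_left[of 2 1 y]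
    scaleR_cancel_left[of 3 x y] by simp

text \<open>
  Exchanging \<open>y\<close> and \<open>z\<close> in the Jordan identity for \<open>{x, y, {x, z, x}}\<close> gives two linear equations
  between three expressions, one of which is symmetric in \<open>y\<close> and \<open>z\<close>; they force all of them to be
  equal.
\<close>

lemma triple_shift:
  "triple x (triple y x z) x = triple (triple x y x) z x"
  "triple (triple x z x) y x = triple (triple x y x) z x"
proof -
  define A where "A y z = triple (triple x z x) y x" for y z
  define C where "C y z = triple x (triple y x z) x" for y z
  have C: "C y z = C z y" for y z unfolding C_def by (simp add: symmetric_outer[of y x z])
  have *: "A y z + C y z = A z y + A z y" for y z
    using jordan_identity[of x y x z x] symmetric_outer[of x y "triple x z x"] symmetric_outer[of x z "triple x y x"]
    unfolding A_def C_def by (simp add: algebra_simps)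
  have "A y z + A y z + A y z = A z y + A z y + A z y"
    using *[of y z] *[of z y] C[of y z] by (simp add: algebra_simps) (metis add.assoc add.commute add_diff_cancel_left')
  then have A: "A y z = A z y" by (rule scaleR_three_cancel)
  show "triple (triple x z x) y x = triple (triple x y x) z x" using A by (simp add: A_def)
  show "triple x (triple y x z) x = triple (triple x y x) z x" using A *[of y z] by (simp add: A_def C_def)
qed

text \<open>
  With \<open>L = e \<box> e\<close> and \<open>Q a = {e, a, e}\<close> these say \<open>L Q = Q\<close>, \<open>Q L = Q\<close>, \<open>Q\<^sup>2 = 2 L\<^sup>2 - L\<close> and, as a
  consequence of \<open>L Q\<^sup>2 = Q\<^sup>2\<close>, \<open>L (1 - L) (1 - 2 L) = 0\<close>. The last equation is the Peirce
  decomposition: the eigenvalues of \<open>L\<close> are among \<open>0\<close>, \<open>1/2\<close> and \<open>1\<close>.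
\<close>

lemma tripotent_identities:
  assumes e: "tripotent triple e"
  shows tripotent_box_quadratic: "triple e e (triple e a e) = triple e a e"
    and tripotent_quadratic_box: "triple e (triple e e a) e = triple e a e"
    and tripotent_quadratic_square: "triple e (triple e a e) e = 2 *\<^sub>R triple e e (triple e e a) - triple e e a"
    and tripotent_box_cubic: "2 *\<^sub>R triple e e (triple e e (triple e e a)) = 3 *\<^sub>R triple e e (triple e e a) - triple e e a"
proof -
  have e: "triple e e e = e" using e by (simp add: tripotent_def)
  show 1: "triple e (triple e e a) e = triple e a e" for a
    using triple_shift(1)[of e e a] e by simp
  show 2: "triple e e (triple e a e) = triple e a e" for a
    using triple_shift(2)[of e a e] symmetric_outer[of e e "triple e a e"] e by simp
  show 3: "triple e (triple e a e) e = 2 *\<^sub>R triple e e (triple e e a) - triple e e a" for a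
    using jordan_identity[of a e e e e] e symmetric_outer[of a e e] symmetric_outer[of "triple e e a" e e]
    by (simp add: scaleR_2 algebra_simps)
  show "2 *\<^sub>R triple e e (triple e e (triple e e a)) = 3 *\<^sub>R triple e e (triple e e a) - triple e e a"
    using 2[of "triple e a e"] unfolding 3 
    using scaleR_add_left[of 1 2 "triple e e (triple e e a)"] by (simp add: triple_linear algebra_simps)
qed


text \<open>
  The three summands belong to the Peirce projections \<open>1 - 3 L + 2 L\<^sup>2\<close>, \<open>4 L - 4 L\<^sup>2\<close> and \<open>2 L\<^sup>2 - L\<close>
  onto the eigenspaces of \<open>L = e \<box> e\<close> for the eigenvalues \<open>0\<close>, \<open>1/2\<close> and \<open>1\<close>.
\<close>

lemma tripotent_operator_exp:
  assumes e: "tripotent triple e"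
  shows "operator_exp c (triple e e) z =
    (z - 3 *\<^sub>R triple e e z + 2 *\<^sub>R triple e e (triple e e z))
    + exp (c / 2) *\<^sub>C (4 *\<^sub>R triple e e z - 4 *\<^sub>R triple e e (triple e e z))
    + exp c *\<^sub>C (2 *\<^sub>R triple e e (triple e e z) - triple e e z)"
proof -
  define L where "L = triple e e"
  define P0 where "P0 = z - 3 *\<^sub>R L z + 2 *\<^sub>R L (L z)"
  define Ph where "Ph = 4 *\<^sub>R L z - 4 *\<^sub>R L (L z)"
  define P1 where "P1 = 2 *\<^sub>R L (L z) - L z"
  have Llin: "L (x + y) = L x + L y" "L (x - y) = L x - L y" "L (r *\<^sub>R x) = r *\<^sub>R L x" for x y r
    by (auto simp: L_def triple_linear)
  have cubic: "2 *\<^sub>R L (L (L z)) = 3 *\<^sub>R L (L z) - L z"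
    using tripotent_box_cubic[OF e] by (simp add: L_def)
  have eig: "L P0 = 0" "L Ph = (1/2) *\<^sub>R Ph" "L P1 = P1"
  proof -
    show "L P0 = 0" unfolding P0_def Llin cubic by simp
    have "L Ph = 4 *\<^sub>R L (L z) - 2 *\<^sub>R (2 *\<^sub>R L (L (L z)))" by (simp add: Ph_def Llin)
    also have "\<dots> = (1/2) *\<^sub>R Ph" unfolding cubic 
      by (simp add: Ph_def algebra_simps) (simp flip: scaleR_add_left)
    finally show "L Ph = (1/2) *\<^sub>R Ph" .
    show "L P1 = P1" unfolding P1_def Llin cubic
      using scaleR_add_left[of 2 1 "L (L z)"] by (simp add: algebra_simps)
  qed
  have dec: "z = P0 + Ph + P1"
    unfolding P0_def Ph_def P1_def
    using scaleR_add_left[of 3 1 "L z"] scaleR_add_left[of 2 2 "L (L z)"] by (simp add: algebra_simps)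
  have pow: "(L ^^ n) z = (0 ^ n) *\<^sub>R P0 + ((1/2) ^ n) *\<^sub>R Ph + P1" for n
  proof (induction n)
    case 0 show ?case using dec by simp
  next
    case (Suc n) then show ?case by (simp add: Llin eig)
  qed
  have exp_sums: "(\<lambda>n. (a ^ n / fact n) *\<^sub>C x) sums (exp a *\<^sub>C x)" for a :: complex and x :: 'z
    using bounded_linear.sums[OF bounded_linear_scaleC_left exp_converges[of a], of x]
    by (simp add: scaleR_conv_of_real divide_inverse mult.commute)
  have nth: "(c ^ n / fact n) *\<^sub>C (L ^^ n) z =
      (0 ^ n / fact n) *\<^sub>C P0 + ((c / 2) ^ n / fact n) *\<^sub>C Ph + (c ^ n / fact n) *\<^sub>C P1" for n
  proof -
    have "(c ^ n / fact n) *\<^sub>C (r *\<^sub>R x) = (c ^ n * of_real r / fact n) *\<^sub>C x" for r and x :: 'z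
      by (simp add: scaleC_scaleC flip: scaleC_of_real)
    then show ?thesis unfolding pow scaleC_add_right
      by (simp add: power_mult_distrib power_divide) (cases n; simp)
  qed
  have "(\<lambda>n. (c ^ n / fact n) *\<^sub>C (L ^^ n) z) sums (exp 0 *\<^sub>C P0 + exp (c / 2) *\<^sub>C Ph + exp c *\<^sub>C P1)"
    unfolding nth by (intro sums_add exp_sums)
  then show ?thesis unfolding operator_exp_def L_def[symmetric] P0_def Ph_def P1_def
    by (simp add: sums_iff)
qed

text \<open>
  Since \<open>\<parallel>e\<parallel>\<^sup>2 = \<parallel>e \<box> e\<parallel>\<close>, the claim is that \<open>L = e \<box> e\<close> is a contraction. The Peirce
  decomposition gives \<open>L - 1/2 = - (exp (i \<pi> L) + exp (- i \<pi> L)) / 4\<close>, and the exponentials are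
  isometries because \<open>L\<close> is Hermitian. So \<open>\<parallel>L\<parallel> \<le> 1/2 + 1/2\<close>.
\<close>

lemma tripotent_norm_le_one:
  assumes e: "tripotent triple e"
  shows "norm e \<le> 1"
proof -
  have "norm (triple e e z) \<le> 1 * norm z" for z
  proof -
    let ?E = "\<lambda>t. operator_exp (\<i> * of_real t) (triple e e) z"
    have iso: "norm (?E t) = norm z" for t
      using hermitian_box[of e] by (simp add: hermitian_operator_def)
    have cis: "exp (\<i> * of_real t) = cis t" "exp (\<i> * of_real t / 2) = cis (t / 2)" for t
      using cis_conv_exp[of "t / 2"] by (simp_all add: cis_conv_exp)
    have expi: "cis pi = -1" "cis (- pi) = -1" "cis (pi / 2) = \<i>" "cis (- pi / 2) = - \<i>"
      by (simp_all add: complex_eq_iff)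
    have neg: "(- c) *\<^sub>C x = - (c *\<^sub>C x)" for c and x :: 'z
      by (metis scaleC_scaleC scaleC_minus_one mult_minus1)
    have "?E pi + ?E (- pi) = 2 *\<^sub>R (z - 3 *\<^sub>R triple e e z + 2 *\<^sub>R triple e e (triple e e z))
        - 2 *\<^sub>R (2 *\<^sub>R triple e e (triple e e z) - triple e e z)"
      unfolding tripotent_operator_exp[OF e] cis expi neg scaleC_one scaleR_2 by simp
    also have "\<dots> = 2 *\<^sub>R z - 4 *\<^sub>R triple e e z"
      using scaleR_add_left[of 4 2 "triple e e z"] by (simp add: algebra_simps)
    finally have "?E pi + ?E (- pi) = 2 *\<^sub>R z - 4 *\<^sub>R triple e e z" .
    then have "4 *\<^sub>R triple e e z = 2 *\<^sub>R z - ?E pi - ?E (- pi)" by (simp add: algebra_simps)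
    then have "4 * norm (triple e e z) = norm (2 *\<^sub>R z - ?E pi - ?E (- pi))"
      by (metis abs_numeral norm_scaleR)
    also have "\<dots> \<le> 2 * norm z + norm z + norm z"
      using norm_triangle_ineq4[of "2 *\<^sub>R z - ?E pi" "?E (- pi)"] norm_triangle_ineq4[of "2 *\<^sub>R z" "?E pi"]
        iso[of pi] iso[of "- pi"] norm_scaleR[of 2 z] by linarith
    finally show ?thesis by simp
  qed
  then have "onorm (triple e e) \<le> 1" by (intro onorm_bound) auto
  then have "(norm e)\<^sup>2 \<le> 1" by (simp add: onorm_box)
  then show ?thesis by (simp only: abs_square_le_1 abs_norm_cancel)
qed

lemma maximal_tripotents_eq:
  "maximal_tripotents triple = {e. tripotent triple e \<and> (\<forall>z. triple e e z = 0 \<longrightarrow> z = 0)}"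
proof -
  have "{z. triple e e z = 0} = {0} \<longleftrightarrow> (\<forall>z. triple e e z = 0 \<longrightarrow> z = 0)" for e
    using triple_zero(3)[of e e] by blast
  then show ?thesis by (simp add: maximal_tripotents_def)
qed

lemma maximal_tripotents_subset_cball: "maximal_tripotents triple \<subseteq> cball 0 1"
proof
  fix e assume "e \<in> maximal_tripotents triple"
  then have "tripotent triple e" by (simp add: maximal_tripotents_eq)
  then show "e \<in> cball 0 1" by (simp add: tripotent_norm_le_one)
qed

text \<open>
  Maximality says that \<open>L = e \<box> e\<close> is injective, and \<open>L\<close> annihilates the range of the Peirce
  projection \<open>1 - 3 L + 2 L\<^sup>2\<close>. Unlike the definition, this description is visibly closed and visibly
  invariant under automorphisms.
\<close>

lemma maximal_tripotent_iff_peirce_zero: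
  "e \<in> maximal_tripotents triple \<longleftrightarrow>
     tripotent triple e \<and> (\<forall>z. z - 3 *\<^sub>R triple e e z + 2 *\<^sub>R triple e e (triple e e z) = 0)"
    (is "_ \<longleftrightarrow> _ \<and> (\<forall>z. ?P z = 0)")
proof (intro iffI conjI allI)
  assume e: "e \<in> maximal_tripotents triple"
  then show t: "tripotent triple e" by (simp add: maximal_tripotents_def)
  fix z
  have "triple e e (?P z) = 0" using tripotent_box_cubic[OF t, of z] by (simp add: triple_linear)
  then show "?P z = 0" using e unfolding maximal_tripotents_eq by blast
next
  assume t: "tripotent triple e \<and> (\<forall>z. ?P z = 0)"
  have "z = 0" if "triple e e z = 0" for z 
  proof -
    have "?P z = 0" using t by blast
    then show "z = 0" unfolding that by simp
  qed
  then show "e \<in> maximal_tripotents triple" using t unfolding maximal_tripotents_eq by blast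
qed

lemma unitary_subset_maximal: "unitary_tripotents triple \<subseteq> maximal_tripotents triple"
proof
  fix e assume "e \<in> unitary_tripotents triple"
  then have "tripotent triple e" "\<And>z. triple e e z = z" by (auto simp: unitary_tripotents_def)
  then show "e \<in> maximal_tripotents triple" unfolding maximal_tripotents_eq by simp
qed

lemma closed_tripotents: "closed {e. tripotent triple e}"
  unfolding tripotent_def by (intro closed_Collect_eq continuous_intros)

lemma closed_maximal_tripotents: "closed (maximal_tripotents triple)"
proof -
  have "maximal_tripotents triple = {e. tripotent triple e} \<inter>
      (\<Inter>z. {e. z - 3 *\<^sub>R triple e e z + 2 *\<^sub>R triple e e (triple e e z) = 0})"
    using maximal_tripotent_iff_peirce_zero by blast
  then show ?thesis
    by (auto intro!: closed_Int closed_tripotents closed_INT closed_Collect_eq continuous_intros)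
qed

lemma closed_unitary_tripotents: "closed (unitary_tripotents triple)"
proof -
  have "unitary_tripotents triple = {e. tripotent triple e} \<inter> (\<Inter>z. {e. triple e e z = z})"
    by (auto simp: unitary_tripotents_def)
  then show ?thesis
    by (auto intro!: closed_Int closed_tripotents closed_INT closed_Collect_eq continuous_intros)
qed

section \<open>Automorphisms and derivations\<close>

definition triple_automorphism :: "('z \<Rightarrow> 'z) \<Rightarrow> bool" where
  "triple_automorphism T \<longleftrightarrow> linear T \<and> bij T \<and> (\<forall>x y z. T (triple x y z) = triple (T x) (T y) (T z))"

definition automorphism_invariant :: "'z set \<Rightarrow> bool" where
  "automorphism_invariant G \<longleftrightarrow> (\<forall>T. triple_automorphism T \<longrightarrow> (\<forall>e\<in>G. T e \<in> G))"

lemma tripotent_automorphism: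
  assumes T: "triple_automorphism T" and e: "tripotent triple e"
  shows "tripotent triple (T e)"
proof -
  have "T (triple e e e) = triple (T e) (T e) (T e)" using T unfolding triple_automorphism_def by blast
  then show ?thesis using e by (simp add: tripotent_def)
qed

lemma unitary_tripotents_automorphism:
  assumes T: "triple_automorphism T" and e: "e \<in> unitary_tripotents triple"
  shows "T e \<in> unitary_tripotents triple"
proof -
  have "triple (T e) (T e) z = z" for z
  proof -
    obtain x where x: "z = T x" using T unfolding triple_automorphism_def bij_def surj_def by blast
    have "T (triple e e x) = triple (T e) (T e) (T x)" using T unfolding triple_automorphism_def by blast
    moreover have "triple e e x = x" using e by (simp add: unitary_tripotents_def)
    ultimately show ?thesis unfolding x by simp
  qed
  moreover have "tripotent triple (T e)"
    using e by (intro tripotent_automorphism[OF T]) (simp add: unitary_tripotents_def)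
  ultimately show ?thesis by (simp add: unitary_tripotents_def)
qed

lemma maximal_tripotents_automorphism:
  assumes T: "triple_automorphism T" and e: "e \<in> maximal_tripotents triple"
  shows "T e \<in> maximal_tripotents triple"
proof -
  have lin: "linear T" using T by (simp add: triple_automorphism_def)
  have te: "tripotent triple e" 
    and Pe: "x - 3 *\<^sub>R triple e e x + 2 *\<^sub>R triple e e (triple e e x) = 0" for x
    using iffD1[OF maximal_tripotent_iff_peirce_zero e] by blast+
  have "z - 3 *\<^sub>R triple (T e) (T e) z + 2 *\<^sub>R triple (T e) (T e) (triple (T e) (T e) z) = 0" for z
  proof -
    obtain x where x: "z = T x" using T unfolding triple_automorphism_def bij_def surj_def by blast
    have hom: "triple (T e) (T e) (T y) = T (triple e e y)" for y
      using T unfolding triple_automorphism_def by metis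
    show ?thesis unfolding x hom
      by (simp add: Pe linear_0[OF lin] flip: linear_scale[OF lin] linear_diff[OF lin] linear_add[OF lin])
  qed
  then show ?thesis using maximal_tripotent_iff_peirce_zero tripotent_automorphism[OF T te] by blast
qed

text \<open>
  The two outer slots contribute \<open>c\<^sup>2\<close> and the inner one \<open>cnj c\<close>, and \<open>c\<^sup>2 cnj c = c\<close>.
\<close>

lemma unimodular_automorphism:
  assumes "cmod c = 1"
  shows "triple_automorphism (\<lambda>x. c *\<^sub>C x)"
proof -
  have cc: "c * cnj c = 1" using assms by (simp add: complex_norm_square[symmetric])
  have "bij (\<lambda>x::'z. c *\<^sub>C x)"
    by (rule o_bij[of "\<lambda>x. cnj c *\<^sub>C x"])
      (use cc in \<open>simp_all add: fun_eq_iff scaleC_scaleC mult.commute\<close>)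
  moreover have "linear (\<lambda>x::'z. c *\<^sub>C x)" by (rule bounded_linear.linear[OF bounded_linear_scaleC])
  moreover have "c *\<^sub>C triple x y z = triple (c *\<^sub>C x) (c *\<^sub>C y) (c *\<^sub>C z)" for x y z
  proof -
    have "c * (cnj c * c) = c" using cc by (simp add: mult.commute)
    then show ?thesis
      by (simp only: triple_scaleC_left triple_scaleC_middle triple_scaleC_right scaleC_scaleC)
  qed
  ultimately show ?thesis unfolding triple_automorphism_def by blast
qed

definition triple_derivation :: "('z \<Rightarrow> 'z) \<Rightarrow> bool" where
  "triple_derivation D \<longleftrightarrow> (\<forall>x y z. D (triple x y z) = triple (D x) y z + triple x (D y) z + triple x y (D z))"

text \<open>
  By the product rule and the derivation property, \<open>t \<mapsto> {exp (t D) x, exp (t D) y, exp (t D) z}\<close>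
  solves \<open>u' = D u\<close>, so it is \<open>exp (t D) {x, y, z}\<close> by uniqueness.
\<close>

lemma linear_flow_derivation_automorphism:
  assumes D: "bounded_linear D" and K: "\<And>x. norm (D x) \<le> K * norm x" "0 \<le> K" "K \<le> 1/2"
    and der: "triple_derivation D"
  shows "triple_automorphism (linear_flow D 1)"
  unfolding triple_automorphism_def
proof (intro conjI allI)
  show "linear (linear_flow D 1)" by (rule linear_linear_flow[OF D K])
  show "bij (linear_flow D 1)"
  proof (rule o_bij)
    have mD: "bounded_linear (\<lambda>x. - D x)" using D by (rule bounded_linear_minus)
    show "linear_flow (\<lambda>x. - D x) 1 \<circ> linear_flow D 1 = id"
      using linear_flow_inverse[OF D K] by auto
    show "linear_flow D 1 \<circ> linear_flow (\<lambda>x. - D x) 1 = id"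
      using linear_flow_inverse[OF mD _ K(2,3)] K(1) by auto
  qed
  fix x y z
  note u = linear_flow_has_vector_derivative[OF D K(1)]
  show "linear_flow D 1 (triple x y z) = triple (linear_flow D 1 x) (linear_flow D 1 y) (linear_flow D 1 z)"
  proof (rule small_linear_ode_unique[OF D K, of "\<lambda>t. linear_flow D t (triple x y z)" 
        "\<lambda>t. triple (linear_flow D t x) (linear_flow D t y) (linear_flow D t z)"])
    show "((\<lambda>t. triple (linear_flow D t x) (linear_flow D t y) (linear_flow D t z)) has_vector_derivative
        D (triple (linear_flow D t x) (linear_flow D t y) (linear_flow D t z))) (at t within {0..1})"
      if "t \<in> {0..1}" for t
      using has_vector_derivative_triple[OF u u u, OF that that that, of x y z] der 
      by (simp add: triple_derivation_def)
  qed (auto intro: u)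
qed

definition inner_derivation :: "'z \<Rightarrow> 'z \<Rightarrow> 'z \<Rightarrow> 'z" where
  "inner_derivation u v x = triple u v x - triple v u x"

lemma inner_derivation_derivation: "triple_derivation (inner_derivation u v)"
  unfolding triple_derivation_def inner_derivation_def
  by (simp add: jordan_identity[of u v] jordan_identity[of v u] triple_linear algebra_simps)

lemma norm_inner_derivation_le: "norm (inner_derivation u v x) \<le> 8 * norm u * norm v * norm x"
  unfolding inner_derivation_def
  using norm_triangle_ineq4[of "triple u v x" "triple v u x"] norm_triple_le[of u v x] norm_triple_le[of v u x]
  by (simp add: mult_ac)

lemma bounded_linear_inner_derivation: "bounded_linear (inner_derivation u v)"
  unfolding inner_derivation_def[abs_def] by (intro bounded_linear_sub bounded_linear_triple)

text \<open>
  With \<open>v = 2 L a - 3 a\<close> the left-hand side is \<open>Q v - L v = - Q a + 3 L a - 2 L\<^sup>2 a\<close>, and the last two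
  terms make up \<open>a\<close> because the Peirce projection \<open>1 - 3 L + 2 L\<^sup>2\<close> vanishes.
\<close>

lemma maximal_tripotent_tangent:
  assumes "e \<in> maximal_tripotents triple"
  shows "inner_derivation e (2 *\<^sub>R triple e e a - 3 *\<^sub>R a) e = a - triple e a e"
proof -
  have t: "tripotent triple e" and P: "a - 3 *\<^sub>R triple e e a + 2 *\<^sub>R triple e e (triple e e a) = 0"
    using assms maximal_tripotent_iff_peirce_zero by auto
  have "triple a e e = triple e e a" "triple (triple e e a) e e = triple e e (triple e e a)"
    by (simp_all add: symmetric_outer[of _ e e])
  then show ?thesis
    using P tripotent_quadratic_box[OF t, of a] scaleR_add_left[of 2 1 "triple e a e"]
    by (simp add: inner_derivation_def triple_linear algebra_simps)
qed

text \<open>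
  An Euler step for \<open>x' = a - {x, a, x}\<close> from a point of \<open>G\<close> can be replaced, up to a quadratic error,
  by the automorphism \<open>exp (h D)\<close>, which stays in \<open>G\<close>. The constant is \<open>88 = 8 * 11\<close>: the vector
  \<open>v = 2 {e, e, a} - 3 a\<close> has norm at most \<open>(2 * 4 + 3) A\<close>, and \<open>\<parallel>e \<box> v - v \<box> e\<parallel> \<le> 8 \<parallel>e\<parallel> \<parallel>v\<parallel>\<close>.
\<close>

lemma automorphism_step:
  assumes G: "G \<subseteq> maximal_tripotents triple" and inv: "automorphism_invariant G"
    and e: "e \<in> G" and a: "norm a \<le> A" and h: "0 \<le> h" "88 * A * h \<le> 1/2"
  shows "\<exists>y\<in>G. norm (y - e - h *\<^sub>R (a - triple e a e)) \<le> 2 * (88 * A)\<^sup>2 * h\<^sup>2"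
proof -
  define v where "v = 2 *\<^sub>R triple e e a - 3 *\<^sub>R a"
  define D where "D x = h *\<^sub>R inner_derivation e v x" for x
  have em: "e \<in> maximal_tripotents triple" using G e by blast
  then have e1: "norm e \<le> 1" using maximal_tripotents_subset_cball by auto
  have A: "0 \<le> A" using a norm_ge_zero[of a] by linarith
  have "norm (triple e e a) \<le> 4 * norm e * norm e * norm a" by (rule norm_triple_le)
  also have "\<dots> \<le> 4 * 1 * 1 * A" using e1 a by (intro mult_mono) auto
  finally have "norm v \<le> 11 * A"
    unfolding v_def using norm_triangle_ineq4[of "2 *\<^sub>R triple e e a" "3 *\<^sub>R a"] a by simp
  then have "norm (inner_derivation e v x) \<le> 8 * 1 * (11 * A) * norm x" for x
    using e1 A by (intro order_trans[OF norm_inner_derivation_le] mult_mono) auto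
  then have K: "norm (D x) \<le> (88 * A * h) * norm x" for x
    using mult_left_mono[OF _ h(1), of "norm (inner_derivation e v x)" "88 * A * norm x"] h(1)
    by (simp add: D_def mult_ac)
  have D: "bounded_linear D" unfolding D_def[abs_def]
    by (rule bounded_linear_compose[OF bounded_linear_scaleR_right bounded_linear_inner_derivation])
  have "triple_derivation D" using inner_derivation_derivation[of e v]
    by (simp add: triple_derivation_def D_def triple_linear scaleR_add_right)
  then have "triple_automorphism (linear_flow D 1)"
    using A h by (intro linear_flow_derivation_automorphism[OF D K]) auto
  then have "linear_flow D 1 e \<in> G" using inv e by (simp add: automorphism_invariant_def)
  moreover have "D e = h *\<^sub>R (a - triple e a e)"
    unfolding D_def v_def maximal_tripotent_tangent[OF em] ..
  moreover have "norm (linear_flow D 1 e - e - D e) \<le> 2 * (88 * A * h)\<^sup>2 * norm e"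
    using A h by (intro linear_flow_first_order[OF D K]) auto
  moreover have "\<dots> \<le> 2 * (88 * A * h)\<^sup>2 * 1" using e1 by (intro mult_left_mono) auto
  ultimately show ?thesis by (intro bexI[of _ "linear_flow D 1 e"]) (auto simp: power_mult_distrib)
qed

end

section \<open>Euler polygons near a viable set\<close>

text \<open>
  A discrete Gronwall inequality. The recursion is available only while the error is at most \<open>1\<close>,
  which is where a locally Lipschitz vector field is under control; the smallness of \<open>h\<close> keeps the
  error in that range.
\<close>

lemma euler_error_le:
  fixes e :: "nat \<Rightarrow> real"
  assumes e0: "e 0 = 0" and K: "0 \<le> K" and C: "0 \<le> C" and h: "0 \<le> h" "real N * h \<le> 1" "C * exp K * h \<le> 1"
    and step: "\<And>j. j < N \<Longrightarrow> e j \<le> 1 \<Longrightarrow> e (Suc j) \<le> (1 + K * h) * e j + C * h\<^sup>2"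
    and j: "j \<le> N"
  shows "e j \<le> C * exp K * h"
proof -
  define B where "B j = C * (real j * h) * h * (1 + K * h) ^ j" for j
  have B: "B j \<le> C * exp K * h" if "j \<le> N" for j
  proof -
    have jh: "real j * h \<le> 1" using that h by (meson mult_right_mono of_nat_mono order_trans)
    have "(1 + K * h) ^ j \<le> exp (K * h) ^ j" using K h by (intro power_mono) (auto simp: exp_ge_add_one_self)
    also have "\<dots> = exp (K * (real j * h))" by (simp add: exp_of_nat_mult[symmetric] mult_ac)
    also have "\<dots> \<le> exp K" using K jh mult_left_mono[of "real j * h" 1 K] by simp
    finally have "B j \<le> C * 1 * h * exp K"
      unfolding B_def using C h jh K by (intro mult_mono) auto
    then show ?thesis by (simp add: mult_ac)
  qed
  have "j \<le> N \<Longrightarrow> e j \<le> B j" for j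
  proof (induction j)
    case 0 then show ?case using e0 by (simp add: B_def)
  next
    case (Suc j)
    have ej: "e j \<le> B j" using Suc by simp
    have "B j \<le> 1" using B[of j] Suc.prems h(3) by linarith
    then have "e (Suc j) \<le> (1 + K * h) * e j + C * h\<^sup>2" using Suc.prems ej by (intro step) auto
    also have "\<dots> \<le> (1 + K * h) * B j + C * h\<^sup>2 * (1 + K * h) ^ Suc j"
    proof (intro add_mono mult_left_mono)
      show "C * h\<^sup>2 \<le> C * h\<^sup>2 * (1 + K * h) ^ Suc j"
        using mult_left_mono[OF one_le_power[of "1 + K * h" "Suc j"], of "C * h\<^sup>2"] C K h by simp
    qed (use ej K h in auto)
    also have "\<dots> = B (Suc j)" by (simp add: B_def power2_eq_square algebra_simps)
    finally show ?case .
  qed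
  then show ?thesis using B[OF j] j by (meson order_trans)
qed

lemma geometric_Cauchy_limit:
  fixes y :: "nat \<Rightarrow> 'a::banach"
  assumes y: "\<And>m. m \<ge> m0 \<Longrightarrow> norm (y (Suc m) - y m) \<le> M / 2 ^ m"
  shows "\<exists>l. y \<longlonglongrightarrow> l \<and> (\<forall>m\<ge>m0. norm (y m - l) \<le> 2 * M / 2 ^ m)"
proof -
  have diff: "norm (y (m + k) - y m) \<le> 2 * M / 2 ^ m - 2 * M / 2 ^ (m + k)" if "m \<ge> m0" for m k
  proof (induction k)
    case (Suc k)
    have "norm (y (m + Suc k) - y m) \<le> norm (y (Suc (m + k)) - y (m + k)) + norm (y (m + k) - y m)"
      using norm_triangle_ineq[of "y (Suc (m + k)) - y (m + k)" "y (m + k) - y m"] by simp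
    also have "\<dots> \<le> M / 2 ^ (m + k) + (2 * M / 2 ^ m - 2 * M / 2 ^ (m + k))"
      using y[of "m + k"] that Suc by (intro add_mono) auto
    also have "\<dots> = 2 * M / 2 ^ m - 2 * M / 2 ^ (m + Suc k)" by (simp add: field_simps)
    finally show ?case .
  qed simp
  have "0 \<le> M / 2 ^ m0" by (rule order_trans[OF norm_ge_zero y]) simp
  then have "0 \<le> M / 2 ^ m0 * 2 ^ m0" by (rule mult_nonneg_nonneg) simp
  then have M: "0 \<le> M" by simp
  have le: "norm (y (m + k) - y m) \<le> 2 * M / 2 ^ m" if "m \<ge> m0" for m k
  proof -
    have "0 \<le> 2 * M / 2 ^ (m + k)" using M by simp
    then show ?thesis using diff[OF that, of k] by linarith
  qed
  have "(\<lambda>m. 2 * M * (1 / 2) ^ m) \<longlonglongrightarrow> 2 * M * 0" by (intro tendsto_intros LIMSEQ_power_zero) simp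
  then have lim0: "(\<lambda>m. 2 * M / 2 ^ m) \<longlonglongrightarrow> 0" by (simp add: power_divide)
  have "Cauchy y"
  proof (rule CauchyI')
    fix e :: real assume "e > 0"
    then have "\<forall>\<^sub>F m in sequentially. 2 * M / 2 ^ m < e" using order_tendstoD(2)[OF lim0] by blast
    then obtain m1 where m1: "\<And>m. m \<ge> m1 \<Longrightarrow> 2 * M / 2 ^ m < e" by (auto simp: eventually_sequentially)
    have "dist (y m) (y n) < e" if "m \<ge> max m0 m1" "m < n" for m n
      using le[of m "n - m"] m1[of m] that by (simp add: dist_norm norm_minus_commute)
    then show "\<exists>M. \<forall>m\<ge>M. \<forall>n>m. dist (y m) (y n) < e" by blast
  qed
  then obtain l where l: "y \<longlonglongrightarrow> l" using Cauchy_convergent convergent_def by blast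
  have "norm (y m - l) \<le> 2 * M / 2 ^ m" if "m \<ge> m0" for m
  proof (rule tendsto_upperbound)
    show "(\<lambda>k. norm (y m - y (k + m))) \<longlonglongrightarrow> norm (y m - l)"
      by (intro tendsto_intros LIMSEQ_ignore_initial_segment l)
    show "\<forall>\<^sub>F k in sequentially. norm (y m - y (k + m)) \<le> 2 * M / 2 ^ m"
      using le[OF that] by (simp add: norm_minus_commute add.commute)
  qed (rule sequentially_bot)
  then show ?thesis using l by blast
qed

primrec euler :: "(real \<Rightarrow> 'a::real_vector \<Rightarrow> 'a) \<Rightarrow> real \<Rightarrow> nat \<Rightarrow> 'a \<Rightarrow> 'a" where
  "euler F h 0 x = x"
| "euler F h (Suc j) x = euler F h j x + h *\<^sub>R F (real j * h) (euler F h j x)"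

text \<open>
  The assumption on \<open>G\<close> allows a scheme with the same first-order behaviour as Euler's whose
  vertices all lie in \<open>G\<close>. One step of this scheme and two steps of half the size differ by \<open>O(h\<^sup>2)\<close>,
  so the end points for \<open>h = 1 / 2 ^ m\<close> form a Cauchy sequence, with limit in \<open>G\<close>. The Euler polygon
  is compared with the same scheme. All bounds are uniform in the initial value.
\<close>

lemma euler_limit_in_viable_set:
  fixes F :: "real \<Rightarrow> 'a::banach \<Rightarrow> 'a"
  assumes G: "closed G" "G \<subseteq> cball 0 1" and K: "0 \<le> K" and C: "0 \<le> C" and \<delta>: "0 < \<delta>"
    and bd: "\<And>t x. t \<in> {0..1} \<Longrightarrow> norm x \<le> 2 \<Longrightarrow> norm (F t x) \<le> K"
    and lip: "\<And>s t x y. s \<in> {0..1} \<Longrightarrow> t \<in> {0..1} \<Longrightarrow> norm x \<le> 2 \<Longrightarrow> norm y \<le> 2 \<Longrightarrow>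
       norm (F s x - F t y) \<le> K * (\<bar>s - t\<bar> + norm (x - y))"
    and viable: "\<And>t h x. t \<in> {0..1} \<Longrightarrow> 0 \<le> h \<Longrightarrow> h \<le> \<delta> \<Longrightarrow> x \<in> G \<Longrightarrow>
       \<exists>y\<in>G. norm (y - x - h *\<^sub>R F t x) \<le> C * h\<^sup>2"
  shows "\<exists>\<psi> M. 0 \<le> M \<and> (\<forall>x\<in>G. \<psi> x \<in> G) \<and>
    (\<forall>\<^sub>F m in sequentially. \<forall>x\<in>G. norm (euler F (1 / 2 ^ m) (2 ^ m) x - \<psi> x) \<le> M / 2 ^ m)"
proof -
  define S where "S t h x = (SOME y. y \<in> G \<and> norm (y - x - h *\<^sub>R F t x) \<le> C * h\<^sup>2)" for t h x
  have S: "S t h x \<in> G \<and> norm (S t h x - x - h *\<^sub>R F t x) \<le> C * h\<^sup>2"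
    if "t \<in> {0..1}" "0 \<le> h" "h \<le> \<delta>" "x \<in> G" for t h x
    unfolding S_def by (rule someI_ex) (use viable[OF that] in blast)
  define X where "X m j x = rec_nat x (\<lambda>j. S (real j / 2 ^ m) (1 / 2 ^ m)) j" for m j x
  have X0: "X m 0 x = x" and XS: "X m (Suc j) x = S (real j / 2 ^ m) (1 / 2 ^ m) (X m j x)" for m j x
    by (simp_all add: X_def)
  \<comment> \<open>\<open>C2\<close> bounds the defect of two half steps against one Euler step: \<open>2 C\<close> from the steps themselves, the rest from the change of \<open>F\<close> between them. \<open>C3\<close> adds the defect of the full step.\<close>
  define C2 where "C2 = 2 * C + K * (1 + K + C)"
  define C3 where "C3 = C + C2"
  have C2: "0 \<le> C2" and C3: "0 \<le> C3" using K C by (auto simp: C2_def C3_def)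
  define M where "M = C3 * exp K"
  have M: "0 \<le> M" using C3 by (simp add: M_def)
  have lim: "(\<lambda>m. c * (1 / 2) ^ m) \<longlonglongrightarrow> c * 0" for c :: real by (intro tendsto_intros LIMSEQ_power_zero) simp
  have "\<forall>\<^sub>F m in sequentially. 1 * (1/2) ^ m < \<delta> \<and> M * (1/2) ^ m < 1"
    using order_tendstoD(2)[OF lim[of 1], of \<delta>] order_tendstoD(2)[OF lim[of M], of 1] \<delta>
    by (intro eventually_conj) auto
  then obtain m0 where "\<And>m. m \<ge> m0 \<Longrightarrow> 1 * (1/2) ^ m < \<delta> \<and> M * (1/2) ^ m < 1"
    by (auto simp: eventually_sequentially)
  then have m0: "1 / 2 ^ m \<le> \<delta>" "M / 2 ^ m \<le> 1" if "m \<ge> m0" for m 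
    using that by (auto simp: power_divide less_imp_le)
  have t01: "real j / 2 ^ m \<in> {0..1}" if "j \<le> 2 ^ m" for j m
    using that by (simp add: field_simps)
  have XG: "j \<le> 2 ^ m \<Longrightarrow> X m j x \<in> G" if "m \<ge> m0" "x \<in> G" for m j x
    using that m0[OF that(1)] by (induction j) (auto simp: X0 XS intro!: S[THEN conjunct1] t01)
  have X1: "norm (X m j x) \<le> 1" if "m \<ge> m0" "x \<in> G" "j \<le> 2 ^ m" for m j x
    using XG[OF that] G(2) by auto
  have XF: "norm (X m (Suc j) x - X m j x - (1 / 2 ^ m) *\<^sub>R F (real j / 2 ^ m) (X m j x)) \<le> C * (1 / 2 ^ m)\<^sup>2"
    if "m \<ge> m0" "x \<in> G" "j < 2 ^ m" for m j x
    unfolding XS using that m0[OF that(1)] XG[OF that(1,2), of j]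
    by (intro S[THEN conjunct2] t01) auto
  \<comment> \<open>An approximate solution whose one-step error is quadratic stays close to the path in \<open>G\<close>.\<close>
  have compare: "norm (p (2 ^ m) - X m (2 ^ m) x) \<le> M / 2 ^ m"
    if m: "m \<ge> m0" and x: "x \<in> G" and p0: "p 0 = x"
      and p: "\<And>j. j < 2 ^ m \<Longrightarrow> norm (p j) \<le> 2 \<Longrightarrow> 
        norm (p (Suc j) - p j - (1 / 2 ^ m) *\<^sub>R F (real j / 2 ^ m) (p j)) \<le> C2 * (1 / 2 ^ m)\<^sup>2" for p m x
  proof -
    let ?h = "1 / 2 ^ m :: real"
    have "norm (p (2 ^ m) - X m (2 ^ m) x) \<le> C3 * exp K * ?h"
    proof (rule euler_error_le[where N = "2 ^ m" and e = "\<lambda>j. norm (p j - X m j x)"])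
      show "norm (p 0 - X m 0 x) = 0" by (simp add: p0 X0)
      show "C3 * exp K * ?h \<le> 1" using m0(2)[OF m] by (simp add: M_def)
      fix j assume j: "j < (2::nat) ^ m" and close: "norm (p j - X m j x) \<le> 1"
      have q: "norm (X m j x) \<le> 1" using X1[OF m x] j by simp
      then have pj: "norm (p j) \<le> 2" using close norm_triangle_ineq2[of "p j" "X m j x"] by simp
      define a where "a = p (Suc j) - p j - ?h *\<^sub>R F (real j / 2 ^ m) (p j)"
      define b where "b = X m (Suc j) x - X m j x - ?h *\<^sub>R F (real j / 2 ^ m) (X m j x)"
      define d where "d = F (real j / 2 ^ m) (p j) - F (real j / 2 ^ m) (X m j x)"
      have diff: "p (Suc j) - X m (Suc j) x = (p j - X m j x) + ?h *\<^sub>R d + a - b"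
        by (simp add: a_def b_def d_def algebra_simps)
      have "norm (p (Suc j) - X m (Suc j) x) \<le> norm (p j - X m j x) + norm (?h *\<^sub>R d) + norm a + norm b"
        unfolding diff
        using norm_triangle_ineq4[of "(p j - X m j x) + ?h *\<^sub>R d + a" b]
          norm_triangle_ineq[of "(p j - X m j x) + ?h *\<^sub>R d" a]
          norm_triangle_ineq[of "p j - X m j x" "?h *\<^sub>R d"] by linarith
      also have "norm (?h *\<^sub>R d) \<le> ?h * (K * norm (p j - X m j x))"
        using lip[OF t01[of j m] t01[of j m] pj, of "X m j x"] q j by (simp add: d_def divide_right_mono)
      also have "norm a \<le> C2 * ?h\<^sup>2" unfolding a_def by (rule p[OF j pj])
      also have "norm b \<le> C * ?h\<^sup>2" unfolding b_def by (rule XF[OF m x j])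
      finally show "norm (p (Suc j) - X m (Suc j) x) \<le> (1 + K * ?h) * norm (p j - X m j x) + C3 * ?h\<^sup>2"
        by (simp add: C3_def algebra_simps)
    qed (use K C3 in auto)
    then show ?thesis by (simp add: M_def)
  qed
  have euler_close: "norm (euler F (1 / 2 ^ m) (2 ^ m) x - X m (2 ^ m) x) \<le> M / 2 ^ m" 
    if "m \<ge> m0" "x \<in> G" for m x
    by (rule compare[OF that, of "\<lambda>j. euler F (1 / 2 ^ m) j x"]) (use C2 in auto)
  have refine: "norm (X (Suc m) (2 ^ Suc m) x - X m (2 ^ m) x) \<le> M / 2 ^ m" if m: "m \<ge> m0" and x: "x \<in> G" for m x
  proof -
    have "norm (X (Suc m) (2 * 2 ^ m) x - X m (2 ^ m) x) \<le> M / 2 ^ m"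
    proof (rule compare[OF m x, of "\<lambda>j. X (Suc m) (2 * j) x"])
      show "X (Suc m) (2 * 0) x = x" by (simp add: X0)
      fix j assume j: "j < (2::nat) ^ m"
      have m': "Suc m \<ge> m0" using m by simp
      define k :: real where "k = 1 / 2 ^ Suc m"
      let ?t = "real j / 2 ^ m"
      \<comment> \<open>Two half steps, from \<open>p\<close> over \<open>q\<close> to \<open>r\<close>, against one full step from \<open>p\<close>.\<close>
      define p q r where "p = X (Suc m) (2 * j) x" and "q = X (Suc m) (Suc (2 * j)) x"
        and "r = X (Suc m) (Suc (Suc (2 * j))) x"
      have t: "real (2 * j) / 2 ^ Suc m = ?t" and h: "1 / 2 ^ m = 2 * k" by (simp_all add: k_def)
      define s where "s = real (Suc (2 * j)) / 2 ^ Suc m"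
      have s: "s - ?t = k" by (simp add: s_def k_def field_simps)
      have k: "0 \<le> k" "k \<le> 1"
        using one_le_power[of "2::real" "Suc m"] by (simp_all add: k_def divide_le_eq_1 del: power_Suc)
      have 1: "norm (q - p - k *\<^sub>R F ?t p) \<le> C * k\<^sup>2"
        using XF[OF m' x, of "2 * j"] j unfolding t p_def q_def k_def by simp
      have 2: "norm (r - q - k *\<^sub>R F s q) \<le> C * k\<^sup>2"
        using XF[OF m' x, of "Suc (2 * j)"] j unfolding s_def q_def r_def k_def by simp
      have p1: "norm p \<le> 1" and q1: "norm q \<le> 1" unfolding p_def q_def by (rule X1[OF m' x]; use j in simp)+
      have t01': "?t \<in> {0..1}" by (rule t01) (use j in simp)
      have s01: "s \<in> {0..1}" unfolding s_def by (rule t01) (use j in simp)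
      have "norm (q - p) \<le> norm (q - p - k *\<^sub>R F ?t p) + norm (k *\<^sub>R F ?t p)"
        using norm_triangle_ineq[of "q - p - k *\<^sub>R F ?t p" "k *\<^sub>R F ?t p"] by simp
      also have "norm (k *\<^sub>R F ?t p) \<le> k * K"
        unfolding norm_scaleR using bd[OF t01', of p] p1 k by (intro mult_mono) auto
      also have "norm (q - p - k *\<^sub>R F ?t p) \<le> C * k"
        using 1 mult_left_mono[OF mult_left_le_one_le[OF k(1) k(1) k(2)] C] by (simp add: power2_eq_square)
      finally have qp: "norm (q - p) \<le> C * k + k * K" by simp
      have "norm (F s q - F ?t p) \<le> K * (\<bar>s - ?t\<bar> + norm (q - p))"
        using p1 q1 by (intro lip s01 t01') auto
      also have "\<dots> \<le> K * (k + (C * k + k * K))"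
        unfolding s using qp K k by (intro mult_left_mono add_mono) auto
      finally have Fd: "norm (F s q - F ?t p) \<le> K * (1 + K + C) * k" by (simp add: algebra_simps)
      have eq: "r - p - (1 / 2 ^ m) *\<^sub>R F ?t p = 
          (r - q - k *\<^sub>R F s q) + (q - p - k *\<^sub>R F ?t p) + k *\<^sub>R (F s q - F ?t p)"
        unfolding h scaleR_scaleR[symmetric] scaleR_2 scaleR_diff_right by simp
      have "norm (r - p - (1 / 2 ^ m) *\<^sub>R F ?t p) \<le>
          norm (r - q - k *\<^sub>R F s q) + norm (q - p - k *\<^sub>R F ?t p) + norm (k *\<^sub>R (F s q - F ?t p))"
        unfolding eq by (intro norm_triangle_le add_right_mono norm_triangle_ineq)
      also have "\<dots> \<le> C * k\<^sup>2 + C * k\<^sup>2 + k * (K * (1 + K + C) * k)"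
        using 1 2 mult_left_mono[OF Fd k(1)] k(1) by (intro add_mono) auto
      also have "\<dots> = C2 * k\<^sup>2" by (simp add: C2_def power2_eq_square algebra_simps)
      also have "\<dots> \<le> C2 * (1 / 2 ^ m)\<^sup>2"
        unfolding h using C2 k by (intro mult_left_mono power_mono) auto
      finally show "norm (X (Suc m) (2 * Suc j) x - X (Suc m) (2 * j) x - (1 / 2 ^ m) *\<^sub>R F ?t (X (Suc m) (2 * j) x))
          \<le> C2 * (1 / 2 ^ m)\<^sup>2" by (simp add: p_def r_def)
    qed
    then show ?thesis by simp
  qed
  have "\<forall>x\<in>G. \<exists>l. (\<lambda>m. X m (2 ^ m) x) \<longlonglongrightarrow> l \<and> (\<forall>m\<ge>m0. norm (X m (2 ^ m) x - l) \<le> 2 * M / 2 ^ m)"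
    by (intro ballI geometric_Cauchy_limit refine)
  from bchoice[OF this] obtain \<psi> where \<psi>: "\<And>x. x \<in> G \<Longrightarrow> (\<lambda>m. X m (2 ^ m) x) \<longlonglongrightarrow> \<psi> x"
     "\<And>x m. x \<in> G \<Longrightarrow> m \<ge> m0 \<Longrightarrow> norm (X m (2 ^ m) x - \<psi> x) \<le> 2 * M / 2 ^ m" by blast
  have "\<psi> x \<in> G" if x: "x \<in> G" for x
  proof (rule Lim_in_closed_set[OF G(1) _ _ \<psi>(1)[OF x]])
    show "\<forall>\<^sub>F m in sequentially. X m (2 ^ m) x \<in> G"
      unfolding eventually_sequentially using XG[OF _ x] by auto
  qed simp
  moreover have "norm (euler F (1 / 2 ^ m) (2 ^ m) x - \<psi> x) \<le> 3 * M / 2 ^ m" if "m \<ge> m0" "x \<in> G" for m x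
  proof -
    have "norm (euler F (1 / 2 ^ m) (2 ^ m) x - \<psi> x) \<le>
        norm (euler F (1 / 2 ^ m) (2 ^ m) x - X m (2 ^ m) x) + norm (X m (2 ^ m) x - \<psi> x)"
      using norm_triangle_ineq[of "euler F (1 / 2 ^ m) (2 ^ m) x - X m (2 ^ m) x" "X m (2 ^ m) x - \<psi> x"] by simp
    also have "\<dots> \<le> M / 2 ^ m + 2 * M / 2 ^ m" using euler_close[OF that] \<psi>(2)[OF that(2,1)] by (rule add_mono)
    also have "\<dots> = 3 * M / 2 ^ m" by (simp flip: add_divide_distrib)
    finally show ?thesis .
  qed
  then have "\<forall>\<^sub>F m in sequentially. \<forall>x\<in>G. norm (euler F (1 / 2 ^ m) (2 ^ m) x - \<psi> x) \<le> 3 * M / 2 ^ m"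
    unfolding eventually_sequentially by blast
  ultimately show ?thesis using M by (intro exI[of _ \<psi>] exI[of _ "3 * M"]) auto
qed

section \<open>Discs with boundary in a set of tripotents\<close>

context jbstar_triple
begin

lemma triple_sq_diff:
  "triple x a x - triple y a y = triple (x - y) a (x + y)"
  by (simp add: triple_linear symmetric_outer[of y a x])

text \<open>
  The condition on \<open>a\<close> says that \<open>t \<mapsto> t z\<close> solves \<open>x' = a t - {x, a t, x}\<close>. With \<open>L = z \<box> z\<close>, it is
  solved by the Neumann series \<open>a t = \<Sum>n. t ^ (2 * n) L ^ n z\<close>, since \<open>{z, b, z} = L b\<close> for the
  odd powers \<open>b = L ^ n z\<close>.
\<close>

lemma radial_control:
  assumes z: "norm z < 1"
  shows "\<exists>A a. 0 \<le> A \<and> (\<forall>t\<in>{0..1}. a t - t\<^sup>2 *\<^sub>R triple z (a t) z = z) \<and>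
    (\<forall>t\<in>{0..1}. norm (a t) \<le> A) \<and> (\<forall>s\<in>{0..1}. \<forall>t\<in>{0..1}. norm (a s - a t) \<le> A * \<bar>s - t\<bar>)"
proof -
  define L where "L = triple z z"
  define \<rho> where "\<rho> = (norm z)\<^sup>2"
  have \<rho>: "0 \<le> \<rho>" "\<rho> < 1" using z by (auto simp: \<rho>_def abs_square_less_1)
  have L: "bounded_linear L" unfolding L_def by (rule bounded_linear_triple)
  then interpret L: bounded_linear L .
  have Lle: "norm (L x) \<le> \<rho> * norm x" for x unfolding L_def \<rho>_def by (rule norm_triple_self_le)
  have pow: "norm ((L ^^ n) z) \<le> \<rho> ^ n * norm z" for n
  proof (induction n)
    case (Suc n)
    have "norm ((L ^^ Suc n) z) \<le> \<rho> * norm ((L ^^ n) z)" using Lle by simp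
    also have "\<dots> \<le> \<rho> * (\<rho> ^ n * norm z)" using Suc \<rho> by (intro mult_left_mono) auto
    finally show ?case by (simp add: mult.assoc)
  qed simp
  have Q: "triple z ((L ^^ n) z) z = L ((L ^^ n) z)" for n
  proof (induction n)
    case 0 then show ?case by (simp add: L_def)
  next
    case (Suc n)
    have "triple z (L y) z = L (triple z y z)" for y
      using triple_shift[of z z y] symmetric_outer[of z z "triple z y z"] by (simp add: L_def)
    then show ?case using Suc by simp
  qed
  define a where "a t = (\<Sum>n. (t\<^sup>2) ^ n *\<^sub>R (L ^^ n) z)" for t :: real
  have sums: "(\<lambda>n. (t\<^sup>2) ^ n *\<^sub>R (L ^^ n) z) sums a t" if t: "t \<in> {0..1}" for t
    unfolding a_def
  proof (rule summable_sums[OF summable_comparison_test'])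
    show "summable (\<lambda>n. \<rho> ^ n * norm z)" using \<rho> by (intro summable_mult2 summable_geometric) auto
    fix n
    have "t\<^sup>2 \<le> 1" using t by (simp add: abs_square_le_1)
    then have "(t\<^sup>2) ^ n \<le> 1" by (rule power_le_one[rotated]) simp
    then have "norm ((t\<^sup>2) ^ n *\<^sub>R (L ^^ n) z) \<le> 1 * (\<rho> ^ n * norm z)"
      using pow unfolding norm_scaleR by (intro mult_mono) auto
    then show "norm ((t\<^sup>2) ^ n *\<^sub>R (L ^^ n) z) \<le> \<rho> ^ n * norm z" by simp
  qed
  have Qa: "triple z (a t) z = L (a t)" if t: "t \<in> {0..1}" for t
  proof -
    have "(\<lambda>n. (t\<^sup>2) ^ n *\<^sub>R L ((L ^^ n) z)) sums triple z (a t) z"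
      using bounded_linear.sums[OF bounded_linear_triple(2) sums[OF t], of z z] by (simp add: triple_linear Q)
    moreover have "(\<lambda>n. (t\<^sup>2) ^ n *\<^sub>R L ((L ^^ n) z)) sums L (a t)"
      using L.sums[OF sums[OF t]] by (simp add: L.scaleR)
    ultimately show ?thesis by (rule sums_unique2)
  qed
  have eq: "a t - t\<^sup>2 *\<^sub>R L (a t) = z" if t: "t \<in> {0..1}" for t
  proof -
    have "(\<lambda>n. t\<^sup>2 *\<^sub>R L ((t\<^sup>2) ^ n *\<^sub>R (L ^^ n) z)) sums (t\<^sup>2 *\<^sub>R L (a t))"
      by (intro sums_scaleR_right L.sums sums t)
    then have "(\<lambda>n. (t\<^sup>2) ^ Suc n *\<^sub>R (L ^^ Suc n) z) sums (t\<^sup>2 *\<^sub>R L (a t))"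
      by (simp add: L.scaleR)
    then have "(\<lambda>n. (t\<^sup>2) ^ n *\<^sub>R (L ^^ n) z) sums (t\<^sup>2 *\<^sub>R L (a t) + z)"
      using sums_Suc_iff[of "\<lambda>n. (t\<^sup>2) ^ n *\<^sub>R (L ^^ n) z" "t\<^sup>2 *\<^sub>R L (a t)"] by simp
    then have "a t = t\<^sup>2 *\<^sub>R L (a t) + z" by (rule sums_unique2[OF sums[OF t]])
    then show ?thesis by (metis add_diff_cancel_left')
  qed
  \<comment> \<open>The equation bounds its own solution because \<open>L\<close> is a strict contraction.\<close>
  have contr: "(1 - \<rho>) * norm x \<le> norm (x - t\<^sup>2 *\<^sub>R L x)" if t: "t \<in> {0..1}" for t x
  proof -
    have "t\<^sup>2 \<le> 1" using t by (simp add: abs_square_le_1)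
    then have "norm (t\<^sup>2 *\<^sub>R L x) \<le> 1 * (\<rho> * norm x)"
      unfolding norm_scaleR using Lle by (intro mult_mono) auto
    then show ?thesis using norm_triangle_ineq2[of x "t\<^sup>2 *\<^sub>R L x"] by (simp add: algebra_simps)
  qed
  define A0 where "A0 = 1 / (1 - \<rho>)"
  have A0: "A0 > 0" using \<rho> by (simp add: A0_def)
  have inv: "norm x \<le> A0 * c" if "(1 - \<rho>) * norm x \<le> c" for x :: 'z and c
    using that \<rho> by (simp add: A0_def field_simps)
  have bd: "norm (a t) \<le> A0" if t: "t \<in> {0..1}" for t
    using inv[of "a t" 1] contr[OF t, of "a t"] eq[OF t] z by simp
  have lip: "norm (a s - a t) \<le> A0 * (2 * A0) * \<bar>s - t\<bar>" if s: "s \<in> {0..1}" and t: "t \<in> {0..1}" for s t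
  proof -
    have "(a s - a t) - s\<^sup>2 *\<^sub>R L (a s - a t) = (s\<^sup>2 - t\<^sup>2) *\<^sub>R L (a t)"
    proof -
      have "a s - s\<^sup>2 *\<^sub>R L (a s) = a t - t\<^sup>2 *\<^sub>R L (a t)" using eq[OF s] eq[OF t] by simp
      then show ?thesis by (simp add: L.diff algebra_simps)
    qed
    moreover have "norm ((s\<^sup>2 - t\<^sup>2) *\<^sub>R L (a t)) \<le> (\<bar>s - t\<bar> * 2) * (1 * A0)"
      unfolding norm_scaleR
    proof (intro mult_mono)
      have "\<bar>s\<^sup>2 - t\<^sup>2\<bar> = \<bar>s - t\<bar> * \<bar>s + t\<bar>" by (simp add: power2_eq_square square_diff_square_factored abs_mult mult.commute)
      also have "\<dots> \<le> \<bar>s - t\<bar> * 2" using s t by (intro mult_left_mono) auto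
      finally show "\<bar>s\<^sup>2 - t\<^sup>2\<bar> \<le> \<bar>s - t\<bar> * 2" .
      show "norm (L (a t)) \<le> 1 * A0"
        using \<rho> bd[OF t] by (intro order_trans[OF Lle] mult_mono) auto
    qed auto
    ultimately have "(1 - \<rho>) * norm (a s - a t) \<le> (\<bar>s - t\<bar> * 2) * (1 * A0)"
      using contr[OF s, of "a s - a t"] by simp
    from inv[OF this] show ?thesis by (simp add: mult_ac)
  qed
  show ?thesis
  proof (intro exI[of _ "A0 + A0 * (2 * A0)"] exI[of _ a] conjI ballI)
    show "a t - t\<^sup>2 *\<^sub>R triple z (a t) z = z" if "t \<in> {0..1}" for t using eq[OF that] Qa[OF that] by simp
    show "norm (a t) \<le> A0 + A0 * (2 * A0)" if "t \<in> {0..1}" for t using bd[OF that] A0 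
      by (intro order_trans[OF bd[OF that]]) simp
    show "norm (a s - a t) \<le> (A0 + A0 * (2 * A0)) * \<bar>s - t\<bar>" if "s \<in> {0..1}" "t \<in> {0..1}" for s t
      using A0 by (intro order_trans[OF lip[OF that]] mult_right_mono) auto
  qed (use A0 in simp)
qed

definition vector_field :: "(real \<Rightarrow> 'z) \<Rightarrow> real \<Rightarrow> 'z \<Rightarrow> 'z" where
  "vector_field a t x = a t - triple x (a t) x"

text \<open>
  The vector field is a polynomial in \<open>x\<close> that does not involve conjugation of \<open>x\<close>, because the
  conjugate-linear slot of the triple product holds \<open>a t\<close>.
\<close>

lemma euler_vector_field_entire:
  "\<exists>v. ((\<lambda>\<zeta>. euler (vector_field a) h j (\<zeta> *\<^sub>C e)) has_derivative (\<lambda>k. k *\<^sub>C v)) (at \<zeta>)"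
proof (induction j)
  case 0
  show ?case 
    by (auto intro!: exI[of _ e] bounded_linear_imp_has_derivative bounded_linear_scaleC_left)
next
  case (Suc j)
  define p where "p \<zeta> = euler (vector_field a) h j (\<zeta> *\<^sub>C e)" for \<zeta>
  define b where "b = a (real j * h)"
  obtain v where v: "(p has_derivative (\<lambda>k. k *\<^sub>C v)) (at \<zeta>)" using Suc by (auto simp: p_def[abs_def])
  have "((\<lambda>\<zeta>. triple (p \<zeta>) b (p \<zeta>)) has_derivative
      (\<lambda>k. triple (p \<zeta>) b (k *\<^sub>C v) + triple (k *\<^sub>C v) b (p \<zeta>))) (at \<zeta>)"
  proof -
    have "((\<lambda>\<zeta>. box (p \<zeta>) b) has_derivative (\<lambda>k. box (k *\<^sub>C v) b)) (at \<zeta>)"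
      by (rule bounded_linear.has_derivative[OF bounded_bilinear.bounded_linear_left[OF bounded_bilinear_box] v])
    from bounded_bilinear.FDERIV[OF bounded_bilinear_blinfun_apply this v] show ?thesis by simp
  qed
  then have "((\<lambda>\<zeta>. p \<zeta> + h *\<^sub>R (b - triple (p \<zeta>) b (p \<zeta>))) has_derivative
      (\<lambda>k. k *\<^sub>C v + h *\<^sub>R (0 - (triple (p \<zeta>) b (k *\<^sub>C v) + triple (k *\<^sub>C v) b (p \<zeta>))))) (at \<zeta>)"
    by (intro has_derivative_add v has_derivative_scaleR_right has_derivative_diff has_derivative_const)
  moreover have "(\<lambda>k. k *\<^sub>C v + h *\<^sub>R (0 - (triple (p \<zeta>) b (k *\<^sub>C v) + triple (k *\<^sub>C v) b (p \<zeta>)))) =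
      (\<lambda>k. k *\<^sub>C (v - h *\<^sub>R (triple (p \<zeta>) b v + triple v b (p \<zeta>))))"
    by (simp add: triple_scaleC_left triple_scaleC_right scaleC_add_right scaleC_diff_right scaleC_scaleR algebra_simps)
  moreover have "euler (vector_field a) h (Suc j) (\<zeta> *\<^sub>C e) = p \<zeta> + h *\<^sub>R (b - triple (p \<zeta>) b (p \<zeta>))" for \<zeta>
    by (simp add: p_def b_def vector_field_def[of a "real j * h"])
  ultimately show ?case unfolding fun_eq_iff by (intro exI) simp
qed

text \<open>
  The solution \<open>t z\<close> is affine in \<open>t\<close>, so the Euler polygon reproduces it exactly.
\<close>

lemma euler_vector_field_zero:
  assumes a: "\<And>t. t \<in> {0..1} \<Longrightarrow> a t - t\<^sup>2 *\<^sub>R triple z (a t) z = z" and h: "0 \<le> h"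
  shows "real j * h \<le> 1 \<Longrightarrow> euler (vector_field a) h j 0 = (real j * h) *\<^sub>R z"
proof (induction j)
  case (Suc j)
  have jh: "real j * h \<le> 1" using Suc.prems h by (simp add: algebra_simps)
  then have "vector_field a (real j * h) ((real j * h) *\<^sub>R z) = z"
    using a[of "real j * h"] h by (simp add: vector_field_def triple_linear power2_eq_square)
  then show ?case using Suc.IH[OF jh] by (simp add: algebra_simps)
qed simp

text \<open>
  The discs \<open>\<phi> m\<close> are Euler polygons with initial values \<open>\<zeta> e\<close>, for a fixed \<open>e\<close> in \<open>G\<close>. On the circle
  these initial values lie in \<open>G\<close>, because multiplication by \<open>\<zeta>\<close> is an automorphism; at \<open>\<zeta> = 0\<close> the
  polygon runs from \<open>0\<close> to \<open>z\<close>. The bound at interior points will come from the maximum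
  principle.
\<close>

lemma disc_through_point:
  assumes G: "closed G" "G \<subseteq> maximal_tripotents triple" "G \<noteq> {}"
    and inv: "automorphism_invariant G"
    and z: "norm z < 1"
  shows "\<exists>\<phi> \<psi> M. 0 \<le> M \<and> (\<forall>m \<zeta>. \<exists>v. (\<phi> m has_derivative (\<lambda>h. h *\<^sub>C v)) (at \<zeta>)) \<and>
    (\<forall>m. \<phi> m 0 = z) \<and> (\<forall>\<zeta>. cmod \<zeta> = 1 \<longrightarrow> \<psi> \<zeta> \<in> G) \<and>
    (\<forall>\<^sub>F m in sequentially. \<forall>\<zeta>. cmod \<zeta> = 1 \<longrightarrow> norm (\<phi> m \<zeta> - \<psi> \<zeta>) \<le> M / 2 ^ m)"
proof -
  obtain e where e: "e \<in> G" using G(3) by blast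
  obtain A a where A: "0 \<le> A"
    and eq: "\<forall>t\<in>{0..1}. a t - t\<^sup>2 *\<^sub>R triple z (a t) z = z"
    and le: "\<forall>t\<in>{0..1}. norm (a t) \<le> A"
    and lip: "\<forall>s\<in>{0..1}. \<forall>t\<in>{0..1}. norm (a s - a t) \<le> A * \<bar>s - t\<bar>"
    using radial_control[OF z] by (elim exE conjE)
  note a = eq[rule_format] le[rule_format] lip[rule_format]
  let ?F = "vector_field a"
  have G1: "G \<subseteq> cball 0 1" using G(2) maximal_tripotents_subset_cball by blast
  have bd: "norm (?F t x) \<le> 17 * A" if t: "t \<in> {0..1}" and x: "norm x \<le> 2" for t x
  proof -
    have "norm (triple x (a t) x) \<le> 4 * norm x * norm (a t) * norm x" by (rule norm_triple_le)
    also have "\<dots> \<le> 4 * 2 * A * 2" using x a(2)[OF t] A by (intro mult_mono) auto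
    finally show ?thesis
      using a(2)[OF t] norm_triangle_ineq4[of "a t" "triple x (a t) x"] by (simp add: vector_field_def)
  qed
  have lip: "norm (?F s x - ?F t y) \<le> 17 * A * (\<bar>s - t\<bar> + norm (x - y))"
    if s: "s \<in> {0..1}" and t: "t \<in> {0..1}" and x: "norm x \<le> 2" and y: "norm y \<le> 2" for s t x y
  proof -
    have eq: "?F s x - ?F t y = (a s - a t) - triple x (a s - a t) x - triple (x - y) (a t) (x + y)"
      unfolding triple_sq_diff[symmetric] by (simp add: vector_field_def triple_linear)
    have "norm (triple x (a s - a t) x) \<le> 4 * norm x * norm (a s - a t) * norm x" by (rule norm_triple_le)
    also have "\<dots> \<le> 4 * 2 * (A * \<bar>s - t\<bar>) * 2" using x a(3)[OF s t] A by (intro mult_mono) auto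
    finally have 1: "norm (triple x (a s - a t) x) \<le> 16 * A * \<bar>s - t\<bar>" by simp
    have "norm (triple (x - y) (a t) (x + y)) \<le> 4 * norm (x - y) * norm (a t) * norm (x + y)" by (rule norm_triple_le)
    also have "\<dots> \<le> 4 * norm (x - y) * A * 4"
      using x y a(2)[OF t] A norm_triangle_ineq[of x y] by (intro mult_mono) auto
    finally have 2: "norm (triple (x - y) (a t) (x + y)) \<le> 16 * A * norm (x - y)" by (simp add: mult_ac)
    have "norm (?F s x - ?F t y) \<le> A * \<bar>s - t\<bar> + 16 * A * \<bar>s - t\<bar> + 16 * A * norm (x - y)"
      unfolding eq using 1 2 a(3)[OF s t]
        norm_triangle_ineq4[of "a s - a t - triple x (a s - a t) x" "triple (x - y) (a t) (x + y)"]
        norm_triangle_ineq4[of "a s - a t" "triple x (a s - a t) x"] by linarith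
    also have "\<dots> \<le> 17 * A * (\<bar>s - t\<bar> + norm (x - y))"
      using mult_nonneg_nonneg[OF A norm_ge_zero[of "x - y"]] by (simp add: algebra_simps)
    finally show ?thesis .
  qed
  \<comment> \<open>The bound on \<open>h\<close> is chosen so that \<open>88 * A * h \<le> 1/2\<close>, as the exponential of the derivation requires.\<close>
  have viable: "\<exists>y\<in>G. norm (y - x - h *\<^sub>R ?F t x) \<le> 2 * (88 * A)\<^sup>2 * h\<^sup>2"
    if "t \<in> {0..1}" "0 \<le> h" "h \<le> 1 / (1 + 176 * A)" "x \<in> G" for t h x
  proof -
    have "88 * A * h \<le> 88 * A * (1 / (1 + 176 * A))" using that A by (intro mult_left_mono) auto
    also have "\<dots> \<le> 1 / 2" using A by (simp add: field_simps)
    finally show ?thesis unfolding vector_field_def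
      by (intro automorphism_step[OF G(2) inv that(4) a(2)[OF that(1)] that(2)])
  qed
  have "\<exists>\<psi> M. 0 \<le> M \<and> (\<forall>x\<in>G. \<psi> x \<in> G) \<and>
    (\<forall>\<^sub>F m in sequentially. \<forall>x\<in>G. norm (euler ?F (1 / 2 ^ m) (2 ^ m) x - \<psi> x) \<le> M / 2 ^ m)"
  proof (rule euler_limit_in_viable_set[OF G(1) G1, where K = "17 * A" and C = "2 * (88 * A)\<^sup>2"
        and \<delta> = "1 / (1 + 176 * A)"])
    show "0 < 1 / (1 + 176 * A)" "0 \<le> 17 * A" "0 \<le> 2 * (88 * A)\<^sup>2" using A by (simp_all add: add_pos_nonneg)
  qed (fact bd lip viable)+
  then obtain \<psi> M where M: "0 \<le> M" and \<psi>: "\<And>x. x \<in> G \<Longrightarrow> \<psi> x \<in> G"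
    and conv: "\<forall>\<^sub>F m in sequentially. \<forall>x\<in>G. norm (euler ?F (1 / 2 ^ m) (2 ^ m) x - \<psi> x) \<le> M / 2 ^ m"
    by blast
  have circ: "\<zeta> *\<^sub>C e \<in> G" if "cmod \<zeta> = 1" for \<zeta>
    using inv unimodular_automorphism[OF that] e by (simp add: automorphism_invariant_def)
  show ?thesis
  proof (intro exI[of _ "\<lambda>m \<zeta>. euler ?F (1 / 2 ^ m) (2 ^ m) (\<zeta> *\<^sub>C e)"]
      exI[of _ "\<lambda>\<zeta>. \<psi> (\<zeta> *\<^sub>C e)"] exI[of _ M] conjI allI impI)
    have "0 *\<^sub>C e = 0" using scaleC_of_real[of 0 e] by simp
    then show "euler ?F (1 / 2 ^ m) (2 ^ m) (0 *\<^sub>C e) = z" for m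
      using euler_vector_field_zero[OF a(1), of "1 / 2 ^ m" "2 ^ m"] by simp
    show "\<forall>\<^sub>F m in sequentially. \<forall>\<zeta>. cmod \<zeta> = 1 \<longrightarrow>
        norm (euler ?F (1 / 2 ^ m) (2 ^ m) (\<zeta> *\<^sub>C e) - \<psi> (\<zeta> *\<^sub>C e)) \<le> M / 2 ^ m"
      using conv by eventually_elim (use circ in blast)
    show "\<exists>v. ((\<lambda>\<zeta>. euler ?F (1 / 2 ^ m) (2 ^ m) (\<zeta> *\<^sub>C e)) has_derivative (\<lambda>h. h *\<^sub>C v)) (at \<zeta>)" for m \<zeta>
      by (rule euler_vector_field_entire)
    show "\<psi> (\<zeta> *\<^sub>C e) \<in> G" if "cmod \<zeta> = 1" for \<zeta> by (rule \<psi>[OF circ[OF that]])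
  qed (rule M)
qed

section \<open>The image of the ball\<close>

text \<open>
  A continuous function need not be uniformly continuous on the unit ball of an infinite-dimensional
  space. This substitute applies to points that approach a compact set.
\<close>

lemma continuous_near_compact:
  fixes f :: "'a::metric_space \<Rightarrow> 'b::metric_space"
  assumes K: "compact K" "K \<subseteq> S" and f: "continuous_on S f" and \<epsilon>: "\<epsilon> > 0"
  obtains \<delta> where "\<delta> > 0" "\<And>x y. x \<in> K \<Longrightarrow> y \<in> S \<Longrightarrow> dist x y < \<delta> \<Longrightarrow> dist (f x) (f y) < \<epsilon>"
proof -
  have "\<forall>x\<in>K. \<exists>d>0. \<forall>y\<in>S. dist y x < d \<longrightarrow> dist (f y) (f x) < \<epsilon> / 2"
    using f K(2) \<epsilon> half_gt_zero[OF \<epsilon>] unfolding continuous_on_iff by blast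
  then obtain d where d: "\<And>x. x \<in> K \<Longrightarrow> d x > 0"
    "\<And>x y. x \<in> K \<Longrightarrow> y \<in> S \<Longrightarrow> dist y x < d x \<Longrightarrow> dist (f y) (f x) < \<epsilon> / 2" by metis
  obtain \<delta> where \<delta>: "\<delta> > 0" "\<And>x. x \<in> K \<Longrightarrow> \<exists>U\<in>(\<lambda>x. ball x (d x)) ` K. ball x \<delta> \<subseteq> U"
  proof (rule Heine_Borel_lemma[OF K(1), of "(\<lambda>x. ball x (d x)) ` K"])
    show "K \<subseteq> \<Union>((\<lambda>x. ball x (d x)) ` K)" using d(1) by force
  qed auto
  show thesis
  proof (rule that[OF \<delta>(1)])
    fix x y assume x: "x \<in> K" and y: "y \<in> S" and xy: "dist x y < \<delta>"
    obtain c where c: "c \<in> K" "ball x \<delta> \<subseteq> ball c (d c)" using \<delta>(2)[OF x] by blast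
    have "x \<in> ball x \<delta>" "y \<in> ball x \<delta>" using \<delta>(1) xy by auto
    then have "x \<in> ball c (d c)" "y \<in> ball c (d c)" using c(2) by blast+
    then have "dist x c < d c" "dist y c < d c" by (auto simp: dist_commute)
    then have "dist (f x) (f c) < \<epsilon> / 2" "dist (f y) (f c) < \<epsilon> / 2"
      using d(2)[OF c(1)] x y K(2) by blast+
    then show "dist (f x) (f y) < \<epsilon>" by (rule dist_triangle_half_l)
  qed
qed

text \<open>
  Apply the maximum principle to \<open>\<zeta> \<mapsto> f (r m \<phi> m \<zeta>)\<close>, with \<open>r m < 1\<close> tending to \<open>1\<close> slowly enough
  that the shrunk disc lies in the open ball. On the circle these functions are uniformly close to
  \<open>f (\<psi> \<zeta>)\<close>, since \<open>\<psi>\<close> is continuous there and has a compact image.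
\<close>

lemma ball_image_in_closed_hull:
  fixes f :: "'z \<Rightarrow> 'x::complex_banach"
  assumes G: "closed G" "G \<subseteq> maximal_tripotents triple" "G \<noteq> {}"
    and inv: "automorphism_invariant G"
    and hol: "holomorphic_banach f (ball 0 1)" and cont: "continuous_on (cball 0 1) f"
    and z: "norm z < 1"
  shows "f z \<in> closure (convex hull (f ` G))"
proof -
  define C where "C = convex hull (f ` G)"
  have C: "convex C" "C \<noteq> {}" using G(3) by (auto simp: C_def)
  have G1: "G \<subseteq> cball 0 1" using G(2) maximal_tripotents_subset_cball by blast
  obtain \<phi> \<psi> M where M: "0 \<le> M" 
    and \<phi>: "\<forall>m \<zeta>. \<exists>v. (\<phi> m has_derivative (\<lambda>h. h *\<^sub>C v)) (at \<zeta>)"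
    and \<phi>0: "\<forall>m. \<phi> m 0 = z" and \<psi>: "\<forall>\<zeta>. cmod \<zeta> = 1 \<longrightarrow> \<psi> \<zeta> \<in> G"
    and close: "\<forall>\<^sub>F m in sequentially. \<forall>\<zeta>. cmod \<zeta> = 1 \<longrightarrow> norm (\<phi> m \<zeta> - \<psi> \<zeta>) \<le> M / 2 ^ m"
    using disc_through_point[OF G inv z] by (elim exE conjE)
  note \<phi> = \<phi>[rule_format] and \<phi>0 = \<phi>0[rule_format] and \<psi> = \<psi>[rule_format]
  have cont\<phi>: "continuous_on S (\<phi> m)" for S m
    by (rule continuous_at_imp_continuous_on) (use \<phi> has_derivative_continuous in blast)
  have lim: "(\<lambda>m. c / 2 ^ m) \<longlonglongrightarrow> 0" for c :: real
  proof -
    have "(\<lambda>m. c * (1 / 2) ^ m) \<longlonglongrightarrow> c * 0" by (intro tendsto_intros LIMSEQ_power_zero) simp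
    then show ?thesis by (simp add: power_divide)
  qed
  have unif: "uniform_limit (sphere 0 1) \<phi> \<psi> sequentially"
  proof (rule uniform_limitI)
    fix \<epsilon> :: real assume "\<epsilon> > 0"
    from close order_tendstoD(2)[OF lim[of M] this]
    show "\<forall>\<^sub>F m in sequentially. \<forall>\<zeta>\<in>sphere 0 1. dist (\<phi> m \<zeta>) (\<psi> \<zeta>) < \<epsilon>"
      by eventually_elim (force simp: dist_norm)
  qed
  have "continuous_on (sphere 0 1) \<psi>"
    by (intro uniform_limit_theorem[OF always_eventually unif] allI cont\<phi>) simp
  then have K: "compact (\<psi> ` sphere 0 1)" "\<psi> ` sphere 0 1 \<subseteq> cball 0 1"
    using \<psi> G1 by (auto intro!: compact_continuous_image)
  \<comment> \<open>Shrinking by \<open>r m\<close> moves the closed approximating disc into the open ball.\<close>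
  define r where "r m = 1 / (1 + (M + 1) / 2 ^ m)" for m :: nat
  have r: "0 < r m" "r m < 1" "r m * (1 + M / 2 ^ m) < 1" for m
    using M by (auto simp: r_def field_simps add_pos_nonneg)
  have rlim: "r \<longlonglongrightarrow> 1" 
    unfolding r_def[abs_def] using tendsto_divide[OF tendsto_const tendsto_add[OF tendsto_const lim[of "M + 1"]], of 1 1] by simp
  define g where "g m \<zeta> = f (r m *\<^sub>R \<phi> m \<zeta>)" for m \<zeta>
  have "infdist (f z) C \<le> \<epsilon>" if \<epsilon>: "\<epsilon> > 0" for \<epsilon>
  proof -
    obtain \<delta> where \<delta>: "\<delta> > 0" 
      "\<And>x y. x \<in> \<psi> ` sphere 0 1 \<Longrightarrow> y \<in> cball 0 1 \<Longrightarrow> dist x y < \<delta> \<Longrightarrow> dist (f x) (f y) < \<epsilon>"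
      using continuous_near_compact[OF K cont \<epsilon>] by blast
    have "(\<lambda>m. (1 - r m) * (1 + M) + M / 2 ^ m) \<longlonglongrightarrow> (1 - 1) * (1 + M) + 0"
      by (intro tendsto_intros rlim lim)
    then have "\<forall>\<^sub>F m in sequentially. (1 - r m) * (1 + M) + M / 2 ^ m < \<delta>"
      using order_tendstoD(2) \<delta>(1) by fastforce
    with close have "\<forall>\<^sub>F m in sequentially. infdist (g m 0) C \<le> \<epsilon>"
    proof eventually_elim
      fix m
      assume close: "\<forall>\<zeta>. cmod \<zeta> = 1 \<longrightarrow> norm (\<phi> m \<zeta> - \<psi> \<zeta>) \<le> M / 2 ^ m"
        and small: "(1 - r m) * (1 + M) + M / 2 ^ m < \<delta>"
      have bdry: "norm (\<phi> m \<zeta>) \<le> 1 + M / 2 ^ m" if "cmod \<zeta> = 1" for \<zeta>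
        using close[rule_format, OF that] \<psi>[OF that] G1 norm_triangle_ineq2[of "\<phi> m \<zeta>" "\<psi> \<zeta>"] by fastforce
      have "infdist (\<phi> m \<zeta>) {0} \<le> 1 + M / 2 ^ m" if "cmod \<zeta> \<le> 1" for \<zeta>
        by (rule maximum_principle_infdist[OF _ cont\<phi> _ _ _ that])
           (use \<phi> bdry in \<open>auto simp: disc_holomorphic_def\<close>)
      then have disc: "norm (\<phi> m \<zeta>) \<le> 1 + M / 2 ^ m" if "cmod \<zeta> \<le> 1" for \<zeta> using that by simp
      have inball: "norm (r m *\<^sub>R \<phi> m \<zeta>) < 1" if "cmod \<zeta> \<le> 1" for \<zeta>
      proof -
        have "r m * norm (\<phi> m \<zeta>) \<le> r m * (1 + M / 2 ^ m)"
          using disc[OF that] r(1)[of m] by (intro mult_left_mono) auto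
        also have "\<dots> < 1" by (rule r(3))
        finally show ?thesis using r(1)[of m] by simp
      qed
      have gder: "\<exists>v. (g m has_derivative (\<lambda>h. h *\<^sub>C v)) (at \<zeta>)" if \<zeta>: "cmod \<zeta> \<le> 1" for \<zeta>
      proof -
        obtain v where v: "(\<phi> m has_derivative (\<lambda>h. h *\<^sub>C v)) (at \<zeta>)" using \<phi> by blast
        have "r m *\<^sub>R \<phi> m \<zeta> \<in> ball 0 1" using inball[OF \<zeta>] by simp
        then obtain D where D: "bounded_clinear D" "(f has_derivative D) (at (r m *\<^sub>R \<phi> m \<zeta>))"
          using hol unfolding holomorphic_banach_def by blast
        have "(g m has_derivative (\<lambda>h. D (r m *\<^sub>R (h *\<^sub>C v)))) (at \<zeta>)"
          unfolding g_def[abs_def]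
          by (rule has_derivative_compose[OF has_derivative_scaleR_right[OF v] D(2)])
        moreover have "D (r m *\<^sub>R (h *\<^sub>C v)) = h *\<^sub>C D (r m *\<^sub>R v)" for h
          using D(1) by (simp add: bounded_clinear_def clinear_def flip: scaleC_scaleR)
        ultimately show ?thesis by auto
      qed
      show "infdist (g m 0) C \<le> \<epsilon>"
      proof (rule maximum_principle_infdist[OF _ _ C])
        show "disc_holomorphic (g m)" using gder by (simp add: disc_holomorphic_def)
        show "continuous_on (cball 0 1) (g m)"
          by (rule continuous_at_imp_continuous_on) (use gder has_derivative_continuous in fastforce)
        show "infdist (g m \<zeta>) C \<le> \<epsilon>" if \<zeta>: "cmod \<zeta> = 1" for \<zeta>
        proof -
          have "\<psi> \<zeta> - r m *\<^sub>R \<phi> m \<zeta> = (1 - r m) *\<^sub>R \<phi> m \<zeta> - (\<phi> m \<zeta> - \<psi> \<zeta>)" by (simp add: algebra_simps)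
          then have "dist (\<psi> \<zeta>) (r m *\<^sub>R \<phi> m \<zeta>) \<le> norm ((1 - r m) *\<^sub>R \<phi> m \<zeta>) + norm (\<phi> m \<zeta> - \<psi> \<zeta>)"
            unfolding dist_norm by (metis norm_triangle_ineq4)
          also have "\<dots> \<le> (1 - r m) * (1 + M) + M / 2 ^ m"
          proof (intro add_mono)
            have "M / 2 ^ m \<le> M / 1" using M by (intro divide_left_mono) auto
            then have "norm (\<phi> m \<zeta>) \<le> 1 + M" using bdry[OF \<zeta>] by simp
            then show "norm ((1 - r m) *\<^sub>R \<phi> m \<zeta>) \<le> (1 - r m) * (1 + M)"
              using r[of m] by (simp add: mult_left_mono)
          qed (use close \<zeta> in blast)
          finally have "dist (f (\<psi> \<zeta>)) (g m \<zeta>) < \<epsilon>"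
            unfolding g_def using small inball[of \<zeta>] \<zeta> by (intro \<delta>(2)) (auto simp: less_imp_le)
          moreover have "f (\<psi> \<zeta>) \<in> C" unfolding C_def using \<psi>[OF \<zeta>] by (intro hull_inc) blast
          ultimately show ?thesis by (intro infdist_le2) (auto simp: dist_commute)
        qed
      qed simp
    qed
    moreover have "(\<lambda>m. infdist (g m 0) C) \<longlonglongrightarrow> infdist (f z) C"
    proof (rule tendsto_infdist)
      obtain D where "(f has_derivative D) (at z)"
        using hol z unfolding holomorphic_banach_def by (meson mem_ball_0)
      then have "isCont f z" by (rule has_derivative_continuous)
      moreover have "(\<lambda>m. r m *\<^sub>R z) \<longlonglongrightarrow> 1 *\<^sub>R z" by (intro tendsto_intros rlim)
      ultimately show "(\<lambda>m. g m 0) \<longlonglongrightarrow> f z"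
        unfolding g_def \<phi>0 by (intro isCont_tendsto_compose[of z f]) auto
    qed
    ultimately show ?thesis by (intro tendsto_upperbound[OF _ _ sequentially_bot])
  qed
  then have "infdist (f z) C = 0"
    using infdist_nonneg[of "f z" C] field_le_epsilon[of "infdist (f z) C" 0] by simp
  then show ?thesis using C(2) by (simp add: in_closure_iff_infdist_zero C_def)
qed

lemma cball_image_subset_closed_hull:
  fixes f :: "'z \<Rightarrow> 'x::complex_banach"
  assumes G: "closed G" "G \<subseteq> maximal_tripotents triple" "G \<noteq> {}"
    and inv: "automorphism_invariant G"
    and hol: "holomorphic_banach f (ball 0 1)" and cont: "continuous_on (cball 0 1) f"
  shows "f ` cball 0 1 \<subseteq> closure (convex hull (f ` G))"
proof -
  have "f ` closure (ball 0 1) \<subseteq> closure (convex hull (f ` G))"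
    by (rule image_closure_subset) (use cont ball_image_in_closed_hull[OF G inv hol cont] in auto)
  then show ?thesis by simp
qed

text \<open>
  If \<open>\<parallel>f\<parallel>\<close> is bounded on \<open>G\<close>, then the closed ball whose radius is the supremum is closed and convex
  and contains the image of \<open>G\<close>, hence also the closed convex hull of that image.
\<close>

lemma sup_norm_eq_of_closed_hull:
  fixes f :: "'z \<Rightarrow> 'x::complex_banach"
  assumes hull: "f ` B \<subseteq> closure (convex hull (f ` G))" and "G \<subseteq> B"
  shows "(SUP z\<in>B. ennreal (norm (f z))) = (SUP z\<in>G. ennreal (norm (f z)))"
proof (rule antisym)
  let ?s = "SUP z\<in>G. ennreal (norm (f z))"
  show "(SUP z\<in>B. ennreal (norm (f z))) \<le> ?s"
  proof (cases "?s = top")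
    case False
    then obtain c where c: "?s = ennreal c" "0 \<le> c" by (cases ?s) auto
    have "norm (f w) \<le> c" if "w \<in> G" for w
      using SUP_upper[OF that, of "\<lambda>z. ennreal (norm (f z))"] c by (simp add: ennreal_le_iff)
    then have "closure (convex hull (f ` G)) \<subseteq> cball 0 c"
      by (intro closure_minimal hull_minimal) auto
    then have "f ` B \<subseteq> cball 0 c" using hull by simp
    then have "norm (f z) \<le> c" if "z \<in> B" for z using that by force
    then show ?thesis unfolding c(1) by (intro SUP_least ennreal_leI)
  qed (simp only: top_greatest)
qed (use assms(2) in \<open>rule SUP_subset_mono; simp\<close>)

end

theorem proposition4p1:
  fixes triple :: "'z::complex_banach \<Rightarrow> 'z \<Rightarrow> 'z \<Rightarrow> 'z"
    and f :: "'z \<Rightarrow> 'x::complex_banach"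
  assumes "jbstar_triple triple"
    and "holomorphic_banach f (ball 0 1)"
    and "continuous_on (cball 0 1) f"
  shows "(maximal_tripotents triple \<noteq> {} \<longrightarrow>
           f ` cball 0 1 \<subseteq> closure (convex hull (f ` maximal_tripotents triple)) \<and>
           (SUP z\<in>cball 0 1. ennreal (norm (f z))) =
             (SUP z\<in>maximal_tripotents triple. ennreal (norm (f z)))) \<and>
         (unitary_tripotents triple \<noteq> {} \<longrightarrow>
           f ` cball 0 1 \<subseteq> closure (convex hull (f ` unitary_tripotents triple)) \<and>
           (SUP z\<in>cball 0 1. ennreal (norm (f z))) =
             (SUP z\<in>unitary_tripotents triple. ennreal (norm (f z))))"
proof -
  interpret jbstar_triple triple by (rule assms(1))
  have "f ` cball 0 1 \<subseteq> closure (convex hull (f ` G)) \<and>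
      (SUP z\<in>cball 0 1. ennreal (norm (f z))) = (SUP z\<in>G. ennreal (norm (f z)))"
    if "closed G" "G \<subseteq> maximal_tripotents triple" "G \<noteq> {}"
      "automorphism_invariant G" for G
    using cball_image_subset_closed_hull[OF that assms(2,3)] sup_norm_eq_of_closed_hull[of f "cball 0 1" G]
      that(2) maximal_tripotents_subset_cball by blast
  then show ?thesis
    using closed_maximal_tripotents closed_unitary_tripotents unitary_subset_maximal
      maximal_tripotents_automorphism unitary_tripotents_automorphism
    by (simp add: automorphism_invariant_def)
qed

end
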